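(* Let $\mu\ge 0$ be fixed and let $(u_1,u_2,u_3)\in\mathbb{R}^3$. Then $\Lambda=0$ is an eigenvalue of the self-adjoint operator $T(u_1,u_2,u_3)$ if and only if $\lambda=u_3+\mu(\mu+1)$ is an eigenvalue of the Coulomb spheroidal wave equation $$\frac{\mathrm{d}}{\mathrm{d}x}\left((1-x^2)\frac{\mathrm{d}}{\mathrm{d}x}w(x)\right)+\left(\lambda+\beta x+\gamma^2(1-x^2)-\frac{\mu^2}{1-x^2}\right)w(x)=0,\quad -1<x<1,$$ for the parameters $\gamma^2=u_1$ and $\beta=-u_3-2(\mu+1)u_2$.
   Context: Fix a real number $\mu\ge 0$ and set $\alpha:=\frac12(\mu+1)$. The parameters $\beta$ and $\gamma^2$ are real ($\gamma^2$ may be negative). A number $\lambda\in\mathbb{C}$ is called an eigenvalue of the Coulomb spheroidal wave equation (for given $\beta,\gamma^2,\mu$) if the equation has a nontrivial bounded solution $w$ on $(-1,1)$. For $\mathbf{u}=(u_1,u_2,u_3)\in\mathbb{R}^3$ and $0<z<1$ define $$J:=\begin{pmatrix}0&-1\\1&0\end{pmatrix},\quad W(z):=\begin{pmatrix}\frac{1}{1-z}&0\\0&\frac1z\end{pmatrix},\quad H(z,\mathbf{u}):=\begin{pmatrix}2&-\frac{\alpha}{z}+\frac{\alpha}{1-z}+2u_2\\-\frac{\alpha}{z}+\frac{\alpha}{1-z}+2u_2&\frac{u_3}{z}+2(u_1+u_2^2)\end{pmatrix},$$ and the differential expression $\tau y:=W(z)^{-1}\left(Jy'(z)-H(z,\mathbf{u})y(z)\right)$.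 Let $L^2_W((0,1),\mathbb{C}^2)$ be the Hilbert space of (classes of measurable) functions $f:(0,1)\to\mathbb{C}^2$ with $\int_0^1 f(z)^*W(z)f(z)\,\mathrm{d}z<\infty$, with scalar product $\langle f,g\rangle_W=\int_0^1 f(z)^*W(z)g(z)\,\mathrm{d}z$. The operator $T=T(\mathbf{u})=T(u_1,u_2,u_3)$ is $Ty:=\tau y$ with domain $$D(T)=\{y\in L^2_W((0,1),\mathbb{C}^2): y \text{ is locally absolutely continuous on }(0,1)\text{ and }\tau y\in L^2_W((0,1),\mathbb{C}^2)\}.$$ It is self-adjoint ($\tau$ is in the limit point case at both endpoints). *)

theory Defs
  imports "HOL-Analysis.Analysis"
begin

text \<open>
  The \<open>\<epsilon>\<close>-\<open>\<delta>\<close> definition on a compact interval; a finite family of nonoverlapping compact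
  subintervals is rendered by the library's \<^const>\<open>division_of\<close>, and \<^term>\<open>Inf k\<close>, \<^term>\<open>Sup k\<close>
  are the endpoints of the interval \<open>k\<close>.
\<close>

definition abs_continuous_on_interval ::
    "real \<Rightarrow> real \<Rightarrow> (real \<Rightarrow> 'a::real_normed_vector) \<Rightarrow> bool" where
  "abs_continuous_on_interval a b f \<longleftrightarrow>
     (\<forall>\<epsilon>>0. \<exists>\<delta>>0. \<forall>\<D>. \<D> division_of \<Union>\<D> \<and> \<Union>\<D> \<subseteq> {a..b} \<and> (\<Sum>k\<in>\<D>. Sup k - Inf k) < \<delta>
        \<longrightarrow> (\<Sum>k\<in>\<D>. norm (f (Sup k) - f (Inf k))) < \<epsilon>)"

definition locally_abs_continuous_on ::
    "real set \<Rightarrow> (real \<Rightarrow> 'a::real_normed_vector) \<Rightarrow> bool" where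
  "locally_abs_continuous_on S f \<longleftrightarrow>
     (\<forall>a b. a \<le> b \<longrightarrow> {a..b} \<subseteq> S \<longrightarrow> abs_continuous_on_interval a b f)"

abbreviation unit_measure :: "real measure" where
  "unit_measure \<equiv> lebesgue_on {0<..<1}"

definition alpha :: "real \<Rightarrow> real" where
  "alpha \<mu> = (\<mu> + 1) / 2"

definition Jmat :: "complex^2^2" where
  "Jmat = vector [vector [0, -1], vector [1, 0]]"

definition Wmat :: "real \<Rightarrow> complex^2^2" where
  "Wmat z = vector [vector [of_real (1 / (1 - z)), 0],
                    vector [0, of_real (1 / z)]]"

definition Hmat :: "real \<Rightarrow> real^3 \<Rightarrow> real \<Rightarrow> complex^2^2" where
  "Hmat \<mu> u z = vector
     [vector [2, of_real (- alpha \<mu> / z + alpha \<mu> / (1 - z) + 2 * u$2)],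
      vector [of_real (- alpha \<mu> / z + alpha \<mu> / (1 - z) + 2 * u$2),
              of_real (u$3 / z + 2 * (u$1 + (u$2)\<^sup>2))]]"

definition tau :: "real \<Rightarrow> real^3 \<Rightarrow> (real \<Rightarrow> complex^2) \<Rightarrow> real \<Rightarrow> complex^2" where
  "tau \<mu> u y z =
     matrix_inv (Wmat z) *v (Jmat *v vector_derivative y (at z) - Hmat \<mu> u z *v y z)"

text \<open>The product \<open>v\<^sup>* w\<close> of complex column vectors.\<close>

definition adjoint_mult :: "complex^'n \<Rightarrow> complex^'n \<Rightarrow> complex" where
  "adjoint_mult v w = (\<Sum>i\<in>UNIV. cnj (v$i) * w$i)"

text \<open>
  Elements of the weighted space are represented by functions; only their values on \<open>(0,1)\<close>,
  up to null sets, matter. On \<open>(0,1)\<close> the integrand \<open>f\<^sup>* W f\<close> is real and nonnegative, so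
  integrability is finiteness of the integral.
\<close>

definition L2W :: "(real \<Rightarrow> complex^2) set" where
  "L2W = {f. f \<in> borel_measurable unit_measure \<and>
             integrable unit_measure (\<lambda>z. adjoint_mult (f z) (Wmat z *v f z))}"

text \<open>
  A locally absolutely continuous function is differentiable almost everywhere, so the third
  condition is no additional restriction. It is spelled out because
  \<^const>\<open>vector_derivative\<close> has an arbitrary value where the derivative does not exist, and
  \<open>tau \<mu> u y\<close> has its intended meaning only where it does.
\<close>

definition T_domain :: "real \<Rightarrow> real^3 \<Rightarrow> (real \<Rightarrow> complex^2) set" where
  "T_domain \<mu> u =
     {y \<in> L2W. locally_abs_continuous_on {0<..<1} y \<and>
               (AE z in unit_measure. y differentiable (at z)) \<and>
               tau \<mu> u y \<in> L2W}"

definition T_op :: "real \<Rightarrow> real^3 \<Rightarrow> (real \<Rightarrow> complex^2) \<Rightarrow> (real \<Rightarrow> complex^2)" where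
  "T_op \<mu> u y = tau \<mu> u y"

text \<open>Equality in the weighted space is equality almost everywhere.\<close>

definition T_eigenvalue :: "real \<Rightarrow> real^3 \<Rightarrow> complex \<Rightarrow> bool" where
  "T_eigenvalue \<mu> u \<Lambda> \<longleftrightarrow>
     (\<exists>y\<in>T_domain \<mu> u. \<not> (AE z in unit_measure. y z = 0) \<and>
        (AE z in unit_measure. T_op \<mu> u y z = \<Lambda> *s y z))"

text \<open>The parameter \<open>\<gamma>\<^sup>2\<close>, which may be negative, is passed as the real number \<open>\<gamma>2\<close>.\<close>

definition coulomb_spheroidal_solution ::
    "real \<Rightarrow> real \<Rightarrow> real \<Rightarrow> complex \<Rightarrow> (real \<Rightarrow> complex) \<Rightarrow> bool" where
  "coulomb_spheroidal_solution \<mu> \<beta> \<gamma>2 ev w \<longleftrightarrow>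
     (\<forall>x\<in>{-1<..<1}.
        w differentiable (at x) \<and>
        (\<lambda>t. of_real (1 - t\<^sup>2) * vector_derivative w (at t)) differentiable (at x) \<and>
        vector_derivative (\<lambda>t. of_real (1 - t\<^sup>2) * vector_derivative w (at t)) (at x) +
          (ev + of_real (\<beta> * x + \<gamma>2 * (1 - x\<^sup>2) - \<mu>\<^sup>2 / (1 - x\<^sup>2))) * w x = 0)"

definition coulomb_spheroidal_eigenvalue ::
    "real \<Rightarrow> real \<Rightarrow> real \<Rightarrow> complex \<Rightarrow> bool" where
  "coulomb_spheroidal_eigenvalue \<mu> \<beta> \<gamma>2 ev \<longleftrightarrow>
     (\<exists>w. coulomb_spheroidal_solution \<mu> \<beta> \<gamma>2 ev w \<and>
          (\<exists>x\<in>{-1<..<1}. w x \<noteq> 0) \<and> bounded (w ` {-1<..<1}))"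

end

theory Submission
  imports Defs "HOL-Real_Asymp.Real_Asymp"
begin

text \<open>
  Both eigenvalue conditions ask for a nontrivial solution of one and the same system of two first
  order equations on \<open>(0,1)\<close>; they differ only in what they demand at the endpoints, and those
  demands turn out to be equivalent.

  The common system. Put \<open>p(z) = (z(1-z))\<^sup>\<alpha> exp(-2u\<^sub>2z)\<close>, so that \<open>p'/p\<close> is minus the
  off-diagonal entry of \<open>H\<close>. Writing \<open>y\<^sub>1 = a/p\<close> and \<open>y\<^sub>2 = pb\<close> removes the
  terms with that entry from the system \<open>Jy' = Hy\<close> and leaves \<open>a' = gqb\<close>, \<open>b' = -2a/q\<close> with \<open>q = p\<^sup>2\<close> and
  \<open>g = u\<^sub>3/z + 2(u\<^sub>1 + u\<^sub>2\<^sup>2)\<close>. On the other side, under \<open>x = 2z - 1\<close> a solution \<open>w\<close> of the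
  spheroidal equation and \<open>(1-x\<^sup>2)w'\<close> form a first order system as well, and
  \<open>b = mw\<close> with \<open>m = sqrt(z(1-z))/p\<close> carries it to the system
  for \<open>(a,b)\<close>. The values of \<open>\<lambda>\<close>, \<open>\<beta>\<close> and \<open>\<gamma>\<^sup>2\<close> are exactly those that make this work
  (\<open>potential_identity\<close>).

  The endpoint conditions. Square integrability of \<open>y\<close> is integrability of
  \<open>|a|\<^sup>2/(q(1-z)) + q|b|\<^sup>2/z\<close>, and boundedness of \<open>w\<close> says that \<open>b\<close> is of order at most
  \<open>(z(1-z))\<close> to the power \<open>-\<mu>/2\<close>. Let \<open>s\<close> be the distance from an endpoint, so that \<open>q\<close> is
  comparable to \<open>s\<^sup>\<mu>\<^sup>+\<^sup>1\<close>. Under either condition \<open>a'\<close> is integrable near \<open>s = 0\<close>, so \<open>a\<close> has a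
  limit there. A limit other than \<open>0\<close> contradicts both conditions: \<open>|a|\<^sup>2/q\<close> and \<open>b'\<close>
  are then as large as \<open>s\<close> to the power \<open>-\<mu>-1\<close>. The lemma \<open>no_moderate_growth_if_steep\<close> handles
  both cases at once, including the logarithmic one at \<open>\<mu> = 0\<close>. So \<open>a\<close> vanishes at the
  endpoint, and integrating \<open>a'\<close> from there and \<open>b'\<close> towards it yields the bounds that give the
  other condition (\<open>decay_if_moderate\<close>, \<open>moderate_if_square_integrable\<close>).

  Regularity. An element of the domain of \<open>T\<close> satisfies \<open>Jy' = Hy\<close> only almost everywhere. The
  fundamental theorem of calculus for absolutely continuous functions shows that it is continuously
  differentiable and satisfies the system at every point.
\<close>

section \<open>Absolutely continuous functions\<close>

text \<open>
  In a Riemann sum, the intervals tagged outside \<open>N\<close> are controlled by differentiability. The gauge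
  confines those tagged in \<open>N\<close> to an open set of small measure around \<open>N\<close>, so their
  total length is small and absolute continuity bounds the increments of \<open>f\<close> over them.
\<close>

theorem fundamental_theorem_of_calculus_abs_continuous:
  fixes f :: "real \<Rightarrow> 'a::banach"
  assumes "a \<le> b" and ac: "abs_continuous_on_interval a b f"
    and "negligible N"
    and deriv: "\<And>x. x \<in> {a..b} - N \<Longrightarrow> (f has_vector_derivative f' x) (at x within {a..b})"
  shows "(f' has_integral (f b - f a)) {a..b}"
proof -
  define g where "g x = (if x \<in> N then 0 else f' x)" for x
  have "(g has_integral (f b - f a)) (cbox a b)"
    unfolding has_integral
  proof (intro allI impI)
    fix e :: real assume "0 < e"
    then have "0 < e / 2" by simp
    then obtain \<delta> where "0 < \<delta>"
      and \<delta>: "\<forall>\<D>. \<D> division_of \<Union>\<D> \<and> \<Union>\<D> \<subseteq> {a..b} \<and> (\<Sum>k\<in>\<D>. Sup k - Inf k) < \<delta> \<longrightarrow>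
        (\<Sum>k\<in>\<D>. norm (f (Sup k) - f (Inf k))) < e / 2"
      using ac[unfolded abs_continuous_on_interval_def, THEN spec, THEN mp, OF \<open>0 < e / 2\<close>]
      by (elim exE conjE) (rule that)
    obtain U where "open U" "N \<subseteq> U" "U - N \<in> lmeasurable" "emeasure lebesgue (U - N) < ennreal \<delta>"
      using sets_lebesgue_outer_open[of N \<delta>] \<open>0 < \<delta>\<close> \<open>negligible N\<close>
      by (metis negligible_iff_null_sets null_setsD2)
    moreover have "N \<in> lmeasurable" "N \<in> null_sets lebesgue"
      using \<open>negligible N\<close> negligible_imp_measurable negligible_iff_null_sets by auto
    ultimately have U: "open U" "N \<subseteq> U" "U \<in> lmeasurable" "measure lebesgue U < \<delta>"
    proof -
      show "U \<in> lmeasurable"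
        using \<open>N \<in> lmeasurable\<close> \<open>N \<subseteq> U\<close> \<open>U - N \<in> lmeasurable\<close> by (rule fmeasurable_Diff_D[rotated 1])
      have "measure lebesgue (U - N) < \<delta>"
        using \<open>emeasure lebesgue (U - N) < ennreal \<delta>\<close> \<open>U - N \<in> lmeasurable\<close> \<open>0 < \<delta>\<close>
        by (simp add: emeasure_eq_measure2 ennreal_less_iff)
      then show "measure lebesgue U < \<delta>"
        using measure_Diff_null_set[OF _ \<open>N \<in> null_sets lebesgue\<close>, of U] \<open>U \<in> lmeasurable\<close>
        by (simp add: fmeasurableD)
    qed
    define \<eta> where "\<eta> = e / (2 * (b - a + 1))"
    have "0 < \<eta>" using \<open>0 < e\<close> \<open>a \<le> b\<close> by (simp add: \<eta>_def)
    have "\<forall>x. \<exists>d>0. x \<in> {a..b} - N \<longrightarrow> (\<forall>y\<in>{a..b}. norm (y - x) < d \<longrightarrow>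
        norm (f y - f x - (y - x) *\<^sub>R f' x) \<le> \<eta> * norm (y - x))"
      using deriv[unfolded has_vector_derivative_def has_derivative_within_alt] \<open>0 < \<eta>\<close>
      by blast
    then obtain d where d: "\<And>x. 0 < d x"
      "\<And>x y. x \<in> {a..b} - N \<Longrightarrow> y \<in> {a..b} \<Longrightarrow> norm (y - x) < d x \<Longrightarrow>
        norm (f y - f x - (y - x) *\<^sub>R f' x) \<le> \<eta> * norm (y - x)"
      by metis
    define \<gamma> where "\<gamma> x = (if x \<in> N then U else ball x (d x))" for x
    have "gauge \<gamma>"
      unfolding gauge_def \<gamma>_def using \<open>open U\<close> \<open>N \<subseteq> U\<close> d(1) by auto
    moreover have "norm ((\<Sum>(x, k)\<in>\<D>. measure lborel k *\<^sub>R g x) - (f b - f a)) < e"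
      if \<D>: "\<D> tagged_division_of cbox a b" and fine: "\<gamma> fine \<D>" for \<D>
    proof -
      have K: "Inf K \<in> K" "Sup K \<in> K" "{Inf K..Sup K} \<subseteq> K" "Inf K \<le> x" "x \<le> Sup K" "a \<le> Inf K" "Sup K \<le> b"
          "measure lborel K = Sup K - Inf K" "x \<in> {a..b}"
        if mem: "(x, K) \<in> \<D>" for x K
      proof -
        obtain u v where uv: "K = cbox u v" "x \<in> K" "K \<subseteq> cbox a b"
          using tagged_division_ofD(2,3,4)[OF \<D> mem] by auto
        then have "u \<le> v" by auto
        with uv show "Inf K \<in> K" "Sup K \<in> K" "{Inf K..Sup K} \<subseteq> K" "Inf K \<le> x" "x \<le> Sup K" "a \<le> Inf K" "Sup K \<le> b"
          "measure lborel K = Sup K - Inf K" "x \<in> {a..b}" by auto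
      qed
      have "finite \<D>" using \<D> by blast
      define \<D>N where "\<D>N = {p \<in> \<D>. fst p \<in> N}"
      define err where "err p = measure lborel (snd p) *\<^sub>R g (fst p) - (f (Sup (snd p)) - f (Inf (snd p)))" for p
      have part: "\<D>N tagged_partial_division_of cbox a b"
        by (rule tagged_partial_division_subset[of \<D>])
          (use \<D> in \<open>auto simp: \<D>N_def tagged_division_of_def\<close>)
      have "(\<Sum>(x, k)\<in>\<D>. measure lborel k *\<^sub>R g x) - (f b - f a) = (\<Sum>p\<in>\<D>. err p)"
        using additive_tagged_division_1[OF \<open>a \<le> b\<close>, of \<D> f] \<D>
        by (simp add: err_def sum_subtractf case_prod_unfold)
      also have "\<dots> = (\<Sum>p\<in>\<D> - \<D>N. err p) + (\<Sum>p\<in>\<D>N. err p)"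
        using \<open>finite \<D>\<close> by (intro sum.subset_diff) (auto simp: \<D>N_def)
      finally have split: "norm ((\<Sum>(x, k)\<in>\<D>. measure lborel k *\<^sub>R g x) - (f b - f a))
          \<le> norm (\<Sum>p\<in>\<D> - \<D>N. err p) + norm (\<Sum>p\<in>\<D>N. err p)"
        by (simp add: norm_triangle_ineq)
      have "norm (err p) \<le> \<eta> * measure lborel (snd p)" if "p \<in> \<D> - \<D>N" for p
      proof -
        obtain x k where p: "p = (x, k)" "(x, k) \<in> \<D>" "x \<notin> N"
          using \<open>p \<in> \<D> - \<D>N\<close> by (cases p) (auto simp: \<D>N_def)
        note k = K[OF p(2)]
        define u v where "u = Inf k" and "v = Sup k"
        have "k \<subseteq> ball x (d x)"
          using fineD[OF fine p(2)] p(3) by (simp add: \<gamma>_def)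
        moreover have "u \<in> k" "v \<in> k"
          using k(1,2) by (auto simp: u_def v_def)
        ultimately have "norm (u - x) < d x" "norm (v - x) < d x"
          by (auto simp: dist_norm norm_minus_commute subset_iff)
        then have "norm (f u - f x - (u - x) *\<^sub>R f' x) \<le> \<eta> * norm (u - x)"
            "norm (f v - f x - (v - x) *\<^sub>R f' x) \<le> \<eta> * norm (v - x)"
          using k(4-7,9) p(3) d(2)[of x u] d(2)[of x v] by (auto simp: u_def v_def)
        then have "norm ((f u - f x - (u - x) *\<^sub>R f' x) - (f v - f x - (v - x) *\<^sub>R f' x))
            \<le> \<eta> * norm (u - x) + \<eta> * norm (v - x)"
          using norm_triangle_ineq4 by (rule order_trans[OF _ add_mono, rotated 1])
        also have "(f u - f x - (u - x) *\<^sub>R f' x) - (f v - f x - (v - x) *\<^sub>R f' x) = err p"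
        proof -
          have "err p = (v - u) *\<^sub>R f' x - (f v - f u)"
            using p k(8) by (simp add: err_def g_def u_def v_def)
          then show ?thesis by (simp add: algebra_simps)
        qed
        also have "\<eta> * norm (u - x) + \<eta> * norm (v - x) = \<eta> * measure lborel (snd p)"
          unfolding p(1) snd_conv k(8) using k(4,5)
          by (simp add: u_def v_def flip: distrib_left)
        finally show ?thesis .
      qed
      then have "norm (\<Sum>p\<in>\<D> - \<D>N. err p) \<le> (\<Sum>p\<in>\<D> - \<D>N. \<eta> * measure lborel (snd p))"
        by (rule sum_norm_le)
      also have "\<dots> \<le> (\<Sum>p\<in>\<D>. \<eta> * measure lborel (snd p))"
        using \<open>finite \<D>\<close> \<open>0 < \<eta>\<close> by (intro sum_mono2) auto
      also have "\<dots> = \<eta> * (b - a)"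
        using additive_content_tagged_division[OF \<D>] \<open>a \<le> b\<close>
        by (simp add: case_prod_unfold flip: sum_distrib_left)
      also have "\<dots> < e / 2"
        using \<open>0 < e\<close> \<open>a \<le> b\<close> by (simp add: \<eta>_def field_simps)
      finally have good: "norm (\<Sum>p\<in>\<D> - \<D>N. err p) < e / 2" .
      have dN: "snd ` \<D>N division_of \<Union>(snd ` \<D>N)"
        by (rule partial_division_of_tagged_division[OF part])
      have sub: "\<Union>(snd ` \<D>N) \<subseteq> U" "\<Union>(snd ` \<D>N) \<subseteq> {a..b}"
        using fine \<D> by (fastforce simp: \<D>N_def fine_def \<gamma>_def)+
      have "(\<Sum>k\<in>snd ` \<D>N. Sup k - Inf k) = (\<Sum>k\<in>snd ` \<D>N. measure lebesgue k)"
      proof (intro sum.cong refl)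
        fix k assume "k \<in> snd ` \<D>N"
        then obtain u v where "k = cbox u v" "k \<noteq> {}"
          using division_ofD(3,4)[OF dN] by metis
        then show "Sup k - Inf k = measure lebesgue k" by simp
      qed
      also have "\<dots> = measure lebesgue (\<Union>(snd ` \<D>N))"
        using content_division[OF dN] by simp
      also have "\<dots> \<le> measure lebesgue U"
        using sub(1) U(3) lmeasurable_division[OF dN]
        by (intro measure_mono_fmeasurable) (auto simp: fmeasurableD)
      also have "\<dots> < \<delta>" by (rule U(4))
      finally have "(\<Sum>k\<in>snd ` \<D>N. norm (f (Sup k) - f (Inf k))) < e / 2"
        using \<delta> dN sub(2) by blast
      also have "(\<Sum>k\<in>snd ` \<D>N. norm (f (Sup k) - f (Inf k)))
          = (\<Sum>p\<in>\<D>N. norm (f (Sup (snd p)) - f (Inf (snd p))))"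
      \<comment> \<open>Distinct tags can share an interval only if it is a single point, which contributes nothing.\<close>
      proof (subst sum.reindex_nontrivial)
        show "finite \<D>N" using \<open>finite \<D>\<close> by (simp add: \<D>N_def)
        fix p p' assume p: "p \<in> \<D>N" "p' \<in> \<D>N" "p \<noteq> p'" "snd p = snd p'"
        obtain x x' k where px: "p = (x, k)" "p' = (x', k)"
          using p(4) by (cases p; cases p') auto
        have "interior k \<inter> interior k = {}"
          using tagged_partial_division_ofD(5)[OF part] p px by blast
        then have "interior {Inf k..Sup k} = {}"
          using interior_mono[OF K(3)[of x k]] p(1) px by (simp add: \<D>N_def)
        then have "Inf k = Sup k"
          using K(4,5)[of x k] p(1) px by (simp add: \<D>N_def)
        then show "norm (f (Sup (snd p)) - f (Inf (snd p))) = 0"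
          using px by simp
      qed simp
      also have "\<dots> = (\<Sum>p\<in>\<D>N. norm (err p))"
        by (intro sum.cong) (auto simp: err_def g_def \<D>N_def norm_minus_commute)
      finally have "norm (\<Sum>p\<in>\<D>N. err p) < e / 2"
        using norm_sum[of err \<D>N] by linarith
      with split good show ?thesis by linarith
    qed
    ultimately show "\<exists>\<gamma>. gauge \<gamma> \<and> (\<forall>\<D>. \<D> tagged_division_of cbox a b \<and> \<gamma> fine \<D> \<longrightarrow>
        norm ((\<Sum>(x, k)\<in>\<D>. measure lborel k *\<^sub>R g x) - (f b - f a)) < e)"
      by (intro exI[of _ \<gamma>] conjI allI impI) auto
  qed
  then have "(g has_integral (f b - f a)) {a..b}" by simp
  then show ?thesis
    by (rule has_integral_spike[OF \<open>negligible N\<close>, rotated 1]) (simp add: g_def)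
qed

lemma abs_continuous_on_interval_imp_continuous_on:
  fixes f :: "real \<Rightarrow> 'a::real_normed_vector"
  assumes ac: "abs_continuous_on_interval a b f"
  shows "continuous_on {a..b} f"
  unfolding continuous_on_iff
proof (intro ballI allI impI)
  fix x e :: real assume x: "x \<in> {a..b}" and "0 < e"
  then obtain \<delta> where "0 < \<delta>"
    and \<delta>: "\<forall>\<D>. \<D> division_of \<Union>\<D> \<and> \<Union>\<D> \<subseteq> {a..b} \<and> (\<Sum>k\<in>\<D>. Sup k - Inf k) < \<delta> \<longrightarrow>
      (\<Sum>k\<in>\<D>. norm (f (Sup k) - f (Inf k))) < e"
    using ac[unfolded abs_continuous_on_interval_def, THEN spec, THEN mp, OF \<open>0 < e\<close>]
    by (elim exE conjE) (rule that)
  have *: "norm (f v - f u) < e" if "u \<le> v" "u \<in> {a..b}" "v \<in> {a..b}" "v - u < \<delta>" for u v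
  proof -
    have "{cbox u v} division_of \<Union>{cbox u v}"
      using division_of_self[of u v] that by simp
    with \<delta>[THEN spec, of "{cbox u v}"] that show ?thesis by simp
  qed
  show "\<exists>d>0. \<forall>x'\<in>{a..b}. dist x' x < d \<longrightarrow> dist (f x') (f x) < e"
  proof (intro exI conjI ballI impI)
    fix y assume "y \<in> {a..b}" "dist y x < \<delta>"
    then show "dist (f y) (f x) < e"
      using *[of x y] *[of y x] x by (cases "x \<le> y") (auto simp: dist_norm norm_minus_commute)
  qed fact
qed

lemma locally_abs_continuous_on_imp_continuous_on:
  fixes f :: "real \<Rightarrow> 'a::real_normed_vector"
  assumes ac: "locally_abs_continuous_on S f" and "open S"
  shows "continuous_on S f"
proof (rule continuous_at_imp_continuous_on, rule ballI)
  fix x assume "x \<in> S"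
  then obtain d where "0 < d" "cball x d \<subseteq> S"
    using \<open>open S\<close> open_contains_cball by blast
  then have "continuous_on {x - d..x + d} f"
    using ac unfolding locally_abs_continuous_on_def cball_eq_atLeastAtMost
    by (intro abs_continuous_on_interval_imp_continuous_on) auto
  then show "isCont f x"
    using \<open>0 < d\<close> by (intro continuous_on_interior[of "{x - d..x + d}"]) auto
qed

text \<open>
  An absolutely continuous solution of \<open>y' = F(z,y)\<close> almost everywhere is a classical solution:
  take \<open>g(z) = F(z,y(z))\<close>, which is continuous because \<open>y\<close> is.
\<close>

lemma locally_abs_continuous_on_imp_has_vector_derivative:
  fixes f :: "real \<Rightarrow> 'a::banach"
  assumes ac: "locally_abs_continuous_on S f" and "open S"
    and ae: "AE x in lebesgue_on S. (f has_vector_derivative g x) (at x)"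
    and g: "continuous_on S g" and "x \<in> S"
  shows "(f has_vector_derivative g x) (at x)"
proof -
  obtain d where "0 < d" and "cball x d \<subseteq> S"
    using \<open>open S\<close> \<open>x \<in> S\<close> open_contains_cball by blast
  then have d: "{x - d..x + d} \<subseteq> S"
    by (simp add: cball_eq_atLeastAtMost)
  have "AE x in lebesgue. x \<in> S \<longrightarrow> (f has_vector_derivative g x) (at x)"
    using ae \<open>open S\<close> by (subst (asm) AE_restrict_space_iff) auto
  then obtain N where N: "N \<in> null_sets lebesgue"
      "{x \<in> space lebesgue. \<not> (x \<in> S \<longrightarrow> (f has_vector_derivative g x) (at x))} \<subseteq> N"
    unfolding eventually_ae_filter by blast
  then have "negligible N"
    by (simp add: negligible_iff_null_sets)
  have f_eq: "f y = f (x - d) + integral {x - d..y} g" if y: "y \<in> {x - d..x + d}" for y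
  proof -
    have "(g has_integral (f y - f (x - d))) {x - d..y}"
    proof (rule fundamental_theorem_of_calculus_abs_continuous)
      show "abs_continuous_on_interval (x - d) y f"
        by (rule ac[unfolded locally_abs_continuous_on_def, rule_format]) (use d y in auto)
      show "(f has_vector_derivative g t) (at t within {x - d..y})" if "t \<in> {x - d..y} - N" for t
        by (rule has_vector_derivative_at_within)
          (use N(2) that subsetD[OF d, of t] y in auto)
    qed (use y \<open>negligible N\<close> in auto)
    then show ?thesis by (simp add: integral_unique)
  qed
  have "((\<lambda>y. integral {x - d..y} g) has_vector_derivative g x) (at x within {x - d..x + d})"
    using \<open>0 < d\<close> g d by (intro integral_has_vector_derivative) (auto intro: continuous_on_subset)
  then have "((\<lambda>y. f (x - d) + integral {x - d..y} g) has_vector_derivative 0 + g x)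
      (at x within {x - d..x + d})"
    by (intro has_vector_derivative_add has_vector_derivative_const)
  then have "(f has_vector_derivative g x) (at x within {x - d..x + d})"
    using \<open>0 < d\<close> by (intro has_vector_derivative_transform[OF _ f_eq]) auto
  moreover have "at x within {x - d..x + d} = at x"
    using \<open>0 < d\<close> by (intro at_within_interior) auto
  ultimately show ?thesis by simp
qed

lemma locally_abs_continuous_on_if_continuous_derivative:
  fixes f :: "real \<Rightarrow> 'a::real_normed_vector"
  assumes deriv: "\<And>x. x \<in> S \<Longrightarrow> (f has_vector_derivative g x) (at x)"
    and g: "continuous_on S g"
  shows "locally_abs_continuous_on S f"
  unfolding locally_abs_continuous_on_def abs_continuous_on_interval_def
proof (intro allI impI)
  fix a b e :: real assume "a \<le> b" and ab: "{a..b} \<subseteq> S" and "0 < e"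
  have "bounded (g ` {a..b})"
    using g ab by (intro compact_imp_bounded compact_continuous_image) (auto intro: continuous_on_subset)
  then obtain B where "0 < B" and B: "\<And>x. x \<in> {a..b} \<Longrightarrow> norm (g x) \<le> B"
    unfolding bounded_pos by (metis imageI)
  have lip: "norm (f v - f u) \<le> B * (v - u)" if "u \<in> {a..b}" "v \<in> {a..b}" "u \<le> v" for u v
  proof -
    have "norm (f v - f u) \<le> B * norm (v - u)"
    proof (rule differentiable_bound[of "{a..b}" f "\<lambda>x h. h *\<^sub>R g x"])
      fix x assume x: "x \<in> {a..b}"
      show "(f has_derivative (\<lambda>h. h *\<^sub>R g x)) (at x within {a..b})"
        unfolding has_vector_derivative_def[symmetric]
        by (rule has_vector_derivative_at_within[OF deriv]) (use x ab in auto)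
      show "onorm (\<lambda>h. h *\<^sub>R g x) \<le> B"
        using B[OF x] by (intro onorm_le) (simp add: mult.commute[of B] mult_left_mono)
    qed (use that in auto)
    with that show ?thesis by simp
  qed
  show "\<exists>\<delta>>0. \<forall>\<D>. \<D> division_of \<Union>\<D> \<and> \<Union>\<D> \<subseteq> {a..b} \<and> (\<Sum>k\<in>\<D>. Sup k - Inf k) < \<delta>
        \<longrightarrow> (\<Sum>k\<in>\<D>. norm (f (Sup k) - f (Inf k))) < e"
  proof (intro exI[of _ "e / B"] conjI allI impI)
    fix \<D> assume \<D>: "\<D> division_of \<Union>\<D> \<and> \<Union>\<D> \<subseteq> {a..b} \<and> (\<Sum>k\<in>\<D>. Sup k - Inf k) < e / B"
    have "norm (f (Sup k) - f (Inf k)) \<le> B * (Sup k - Inf k)" if mem: "k \<in> \<D>" for k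
    proof -
      have div: "\<D> division_of \<Union>\<D>" and "k \<subseteq> {a..b}"
        using \<D> mem by auto
      moreover obtain u v where uv: "k = cbox u v"
        using division_ofD(4)[OF div mem] by auto
      moreover have "u \<le> v"
        using division_ofD(3)[OF div mem] uv by simp
      ultimately show ?thesis using lip[of u v] by simp
    qed
    then have "(\<Sum>k\<in>\<D>. norm (f (Sup k) - f (Inf k))) \<le> B * (\<Sum>k\<in>\<D>. Sup k - Inf k)"
      unfolding sum_distrib_left by (rule sum_mono)
    also have "\<dots> < e"
      using \<D> \<open>0 < B\<close> by (simp add: field_simps)
    finally show "(\<Sum>k\<in>\<D>. norm (f (Sup k) - f (Inf k))) < e" .
  qed (use \<open>0 < e\<close> \<open>0 < B\<close> in auto)
qed

section \<open>Limits and growth at zero\<close>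

text \<open>
  The majorant \<open>\<phi>\<close> plays the role of the integral of \<open>|f'|\<close> from \<open>0\<close>: its increments dominate
  those of \<open>f\<close>, so \<open>f\<close> satisfies the Cauchy criterion at \<open>0\<close>.
\<close>

lemma limit_at_zero_of_integrable_derivative:
  fixes f :: "real \<Rightarrow> 'a::banach"
  assumes "0 < r"
    and f: "\<And>s. s \<in> {0<..r} \<Longrightarrow> (f has_vector_derivative f' s) (at s)"
    and \<phi>: "\<And>s. s \<in> {0<..r} \<Longrightarrow> (\<phi> has_real_derivative \<phi>' s) (at s)"
    and le: "\<And>s. s \<in> {0<..r} \<Longrightarrow> norm (f' s) \<le> \<phi>' s"
    and lim: "(\<phi> \<longlongrightarrow> 0) (at_right 0)"
  obtains l where "(f \<longlongrightarrow> l) (at_right 0)"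
    and "\<And>s. s \<in> {0<..r} \<Longrightarrow> norm (f s - l) \<le> \<phi> s"
proof -
  have incr: "norm (f t - f s) \<le> \<phi> t - \<phi> s" if "0 < s" "s \<le> t" "t \<le> r" for s t
  proof (cases "s = t")
    case False
    show ?thesis
    proof (rule differentiable_bound_general[where f' = f' and \<phi>' = \<phi>'])
      show "s < t" using that False by simp
      show "continuous_on {s..t} f"
        using that by (intro continuous_at_imp_continuous_on ballI
          has_vector_derivative_continuous[OF f]) auto
      show "continuous_on {s..t} \<phi>"
        using that by (intro continuous_at_imp_continuous_on ballI DERIV_isCont[OF \<phi>]) auto
    qed (use that f \<phi> le in \<open>auto simp: has_real_derivative_iff_has_vector_derivative\<close>)
  qed simp
  have \<phi>_nonneg: "0 \<le> \<phi> t" if "t \<in> {0<..r}" for t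
  proof (rule tendsto_upperbound[OF lim])
    show "\<forall>\<^sub>F s in at_right 0. \<phi> s \<le> \<phi> t"
      unfolding eventually_at_right_field
    proof (intro exI[of _ t] conjI allI impI)
      fix s assume "0 < s" "s < t"
      then show "\<phi> s \<le> \<phi> t"
        using incr[of s t] that order_trans[OF norm_ge_zero] by force
    qed (use that in simp)
  qed simp
  have "Cauchy (\<lambda>n. f (r / real (Suc n)))"
  proof (rule metric_CauchyI)
    fix e :: real assume "0 < e"
    then have "\<forall>\<^sub>F s in at_right 0. \<phi> s < e"
      by (intro order_tendstoD[OF lim])
    then obtain d where d: "0 < d" "\<And>s. 0 < s \<Longrightarrow> s < d \<Longrightarrow> \<phi> s < e"
      unfolding eventually_at_right_field by auto
    have "(\<lambda>n. r / real (Suc n)) \<longlonglongrightarrow> 0"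
      by real_asymp
    then have "\<forall>\<^sub>F n in sequentially. r / real (Suc n) < d"
      using d(1) by (intro order_tendstoD)
    then obtain M where M: "\<And>n. M \<le> n \<Longrightarrow> r / real (Suc n) < d"
      unfolding eventually_sequentially by auto
    have close: "dist (f s) (f t) < e" if "0 < s" "s \<le> t" "t \<le> r" "t < d" for s t
      using incr[OF that(1-3)] \<phi>_nonneg[of s] d(2)[of t] that by (simp add: dist_norm norm_minus_commute)
    show "\<exists>M. \<forall>m\<ge>M. \<forall>n\<ge>M. dist (f (r / real (Suc m))) (f (r / real (Suc n))) < e"
    proof (intro exI allI impI)
      fix m n assume "M \<le> m" "M \<le> n"
      have "r / real (Suc k) \<le> r" "0 < r / real (Suc k)" for k
        using \<open>0 < r\<close> by (auto simp: field_simps)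
      then show "dist (f (r / real (Suc m))) (f (r / real (Suc n))) < e"
        using close[of "r / real (Suc m)" "r / real (Suc n)"]
          close[of "r / real (Suc n)" "r / real (Suc m)"]
          M[OF \<open>M \<le> m\<close>] M[OF \<open>M \<le> n\<close>]
        by (cases "r / real (Suc m) \<le> r / real (Suc n)") (auto simp: dist_commute)
    qed
  qed
  then obtain l where l: "(\<lambda>n. f (r / real (Suc n))) \<longlonglongrightarrow> l"
    using Cauchy_convergent convergent_def by blast
  have bound: "norm (f s - l) \<le> \<phi> s" if s: "s \<in> {0<..r}" for s
  proof (rule tendsto_upperbound)
    show "(\<lambda>n. norm (f s - f (r / real (Suc n)))) \<longlonglongrightarrow> norm (f s - l)"
      by (intro tendsto_intros l)
    have "(\<lambda>n. r / real (Suc n)) \<longlonglongrightarrow> 0"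
      by real_asymp
    then have "\<forall>\<^sub>F n in sequentially. r / real (Suc n) < s"
      using s by (intro order_tendstoD) auto
    then show "\<forall>\<^sub>F n in sequentially. norm (f s - f (r / real (Suc n))) \<le> \<phi> s"
    proof eventually_elim
      case (elim n)
      have "0 < r / real (Suc n)" "r / real (Suc n) \<le> r" using \<open>0 < r\<close> by (auto simp: field_simps)
      then show ?case
        using incr[of "r / real (Suc n)" s] \<phi>_nonneg[of "r / real (Suc n)"] elim s by auto
    qed
  qed simp
  have "(f \<longlongrightarrow> l) (at_right 0)"
  proof (rule LIM_zero_cancel, rule Lim_null_comparison[OF _ lim])
    show "\<forall>\<^sub>F s in at_right 0. norm (f s - l) \<le> \<phi> s"
      unfolding eventually_at_right_field using bound \<open>0 < r\<close> by (intro exI[of _ r]) auto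
  qed
  with bound show thesis using that by blast
qed

text \<open>
  For \<open>\<mu> > 0\<close> the assumption on \<open>\<psi>'\<close> forces growth like \<open>s\<close> to the power \<open>-\<mu>\<close>, for
  \<open>\<mu> = 0\<close> only like \<open>|ln s|\<close>. Both exceed \<open>s\<close> to the power \<open>-\<mu>/2\<close>, and the comparison function
  \<open>-ln s\<close> times that power covers both cases.
\<close>

lemma no_moderate_growth_if_steep:
  fixes \<psi> :: "real \<Rightarrow> real"
  assumes "0 \<le> \<mu>" "0 < c" "0 < r" "r \<le> 1"
    and \<psi>: "\<And>s. s \<in> {0<..r} \<Longrightarrow> (\<psi> has_real_derivative \<psi>' s) (at s)"
    and steep: "\<And>s. s \<in> {0<..r} \<Longrightarrow> c * s powr (- \<mu> - 1) \<le> \<psi>' s"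
    and growth: "\<And>s. s \<in> {0<..r} \<Longrightarrow> \<bar>\<psi> s\<bar> \<le> K * s powr (- \<mu> / 2)"
  shows False
proof -
  define F where "F s = - (s powr (- \<mu> / 2) * ln s)" for s :: real
  have F: "(F has_real_derivative - (s powr (-\<mu>/2 - 1) * (1 + ln (s powr (- \<mu> / 2))))) (at s)"
    if "0 < s" for s
  proof -
    define e where "e = - \<mu> / 2"
    have "((\<lambda>s. s powr e) has_real_derivative e * s powr (e - 1)) (at s)"
      using that by (rule has_real_derivative_powr)
    then have "((\<lambda>s. - (s powr e * ln s)) has_real_derivative
        - (e * s powr (e - 1) * ln s + s powr e * (1 / s))) (at s)"
      using that by (auto intro!: derivative_eq_intros)
    moreover have "s powr e * (1 / s) = s powr (e - 1)"
      using that by (simp add: powr_diff)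
    ultimately show ?thesis
      unfolding F_def e_def[symmetric] using that
      by (simp add: ln_powr algebra_simps)
  qed
  have F_le: "s powr (-\<mu>/2 - 1) * (1 + ln (s powr (- \<mu> / 2))) \<le> s powr (-\<mu> - 1)" if "0 < s" for s
  proof -
    \<comment> \<open>The inequality \<open>1 + ln t \<le> t\<close> makes \<open>F\<close> grow no faster than the hypothesis allows, uniformly in \<open>\<mu>\<close>.\<close>
    have "1 + ln (s powr (- \<mu> / 2)) \<le> s powr (- \<mu> / 2)"
      using ln_le_minus_one[of "s powr (- \<mu> / 2)"] that by simp
    then have "s powr (-\<mu>/2 - 1) * (1 + ln (s powr (- \<mu> / 2))) \<le> s powr (-\<mu>/2 - 1) * s powr (- \<mu> / 2)"
      by (intro mult_left_mono) auto
    also have "\<dots> = s powr (-\<mu> - 1)"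
      by (simp flip: powr_add)
    finally show ?thesis .
  qed
  have mono: "\<psi> s + c * F s \<le> \<psi> r + c * F r" if "0 < s" "s \<le> r" for s
  proof (rule DERIV_nonneg_imp_nondecreasing[of s r "\<lambda>s. \<psi> s + c * F s"])
    fix t assume t: "s \<le> t" "t \<le> r"
    have "((\<lambda>s. \<psi> s + c * F s) has_real_derivative
        \<psi>' t + c * - (t powr (-\<mu>/2 - 1) * (1 + ln (t powr (- \<mu> / 2))))) (at t)"
      using t that by (intro derivative_intros DERIV_cmult F \<psi>) auto
    moreover have "0 \<le> \<psi>' t + c * - (t powr (-\<mu>/2 - 1) * (1 + ln (t powr (- \<mu> / 2))))"
    proof -
      have "c * (t powr (-\<mu>/2 - 1) * (1 + ln (t powr (- \<mu> / 2)))) \<le> c * t powr (- \<mu> - 1)"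
        by (rule mult_left_mono[OF F_le]) (use t that \<open>0 < c\<close> in auto)
      also have "\<dots> \<le> \<psi>' t"
        using steep[of t] t that by auto
      finally show ?thesis by simp
    qed
    ultimately show "\<exists>y. ((\<lambda>s. \<psi> s + c * F s) has_real_derivative y) (at t) \<and> 0 \<le> y"
      by blast
  qed fact
  define M where "M = \<bar>\<psi> r + c * F r\<bar>"
  have *: "c * - ln s \<le> K + M" if s: "0 < s" "s \<le> r" for s
  proof -
    have one: "1 \<le> s powr (- \<mu> / 2)"
      using powr_mono2'[of "- \<mu> / 2" s 1] assms s by simp
    have "c * F s \<le> M + K * s powr (- \<mu> / 2)"
      using mono[OF s] growth[of s] s unfolding M_def by auto
    also have "\<dots> \<le> M * s powr (- \<mu> / 2) + K * s powr (- \<mu> / 2)"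
      using mult_left_mono[OF one, of M] by (simp add: M_def)
    finally have "s powr (- \<mu> / 2) * (c * - ln s) \<le> s powr (- \<mu> / 2) * (K + M)"
      by (simp add: F_def algebra_simps)
    then show ?thesis
      by (rule mult_left_le_imp_le) (use s in simp)
  qed
  define s where "s = min r (exp (- (K + M) / c - 1))"
  have "0 < s" "s \<le> r" "ln s \<le> - (K + M) / c - 1"
    using \<open>0 < r\<close> ln_mono[of s "exp (- (K + M) / c - 1)"] by (auto simp: s_def)
  then have "c * ln s \<le> c * (- (K + M) / c - 1)"
    using \<open>0 < c\<close> by (intro mult_left_mono) auto
  also have "\<dots> = - (K + M) - c"
    using \<open>0 < c\<close> by (simp add: field_simps)
  finally show False
    using *[of s] \<open>0 < s\<close> \<open>s \<le> r\<close> \<open>0 < c\<close> by simp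
qed

section \<open>The canonical system near a singular endpoint\<close>

text \<open>
  The system \<open>a' = gqb\<close>, \<open>b' = -2a/q\<close> in terms of the distance \<open>s\<close> from an endpoint. Of the first
  equation only the size of \<open>a'\<close> matters, so its sign, which changes under reflection of the
  interval, is left open. The weight \<open>\<rho>\<close> is the one in the square integrability condition on \<open>b\<close>.
  At \<open>z = 0\<close>, where \<open>g\<close> has a pole, it exceeds \<open>q\<close> by the factor \<open>1/z\<close>.
\<close>

locale singular_endpoint =
  fixes \<mu> c C :: real and q \<rho> :: "real \<Rightarrow> real" and a a' b :: "real \<Rightarrow> complex"
  assumes \<mu>_nonneg: "0 \<le> \<mu>" and c_pos: "0 < c" and C_pos: "0 < C"
    and a_deriv: "\<And>s. s \<in> {0<..1/2} \<Longrightarrow> (a has_vector_derivative a' s) (at s)"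
    and a'_le: "\<And>s. s \<in> {0<..1/2} \<Longrightarrow> norm (a' s) \<le> C * (\<rho> s * norm (b s))"
    and b_deriv: "\<And>s. s \<in> {0<..1/2} \<Longrightarrow> (b has_vector_derivative (- 2 / q s) *\<^sub>R a s) (at s)"
    and q_ge: "\<And>s. s \<in> {0<..1/2} \<Longrightarrow> c * s powr (\<mu> + 1) \<le> q s"
    and q_le: "\<And>s. s \<in> {0<..1/2} \<Longrightarrow> q s \<le> C * s powr (\<mu> + 1)"
    and \<rho>_nonneg: "\<And>s. s \<in> {0<..1/2} \<Longrightarrow> 0 \<le> \<rho> s"
    and \<rho>_le: "\<And>s. s \<in> {0<..1/2} \<Longrightarrow> \<rho> s \<le> C * s powr \<mu>"
begin

lemma q_pos: "s \<in> {0<..1/2} \<Longrightarrow> 0 < q s"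
  by (rule less_le_trans[OF _ q_ge]) (use c_pos in auto)

lemma inverse_q_ge: 
  assumes "s \<in> {0<..1/2}"
  shows "1 / C * s powr (- \<mu> - 1) \<le> 1 / q s"
proof -
  have "1 / (C * s powr (\<mu> + 1)) \<le> 1 / q s"
    using q_le[OF assms] q_pos[OF assms] C_pos assms by (intro divide_left_mono) auto
  also have "1 / (C * s powr (\<mu> + 1)) = 1 / C * s powr (- \<mu> - 1)"
    using powr_minus_divide[of s "\<mu> + 1"] by simp
  finally show ?thesis .
qed

text \<open>
  If \<open>a\<close> tends to \<open>l \<noteq> 0\<close>, then the component of \<open>b' = -2a/q\<close> in the direction of \<open>l\<close> eventually has
  constant sign and is bounded below in absolute value by a multiple of \<open>1/q\<close>, so \<open>b\<close> is too steep.
\<close>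

lemma limit_zero_if_moderate:
  assumes lim: "(a \<longlongrightarrow> l) (at_right 0)"
    and b: "\<And>s. s \<in> {0<..1/2} \<Longrightarrow> norm (b s) \<le> K * s powr (- \<mu> / 2)"
  shows "l = 0"
proof (rule ccontr)
  assume "l \<noteq> 0"
  have "((\<lambda>s. Re (cnj l * a s)) \<longlongrightarrow> Re (cnj l * l)) (at_right 0)"
    by (intro tendsto_intros lim)
  moreover have Re_l: "Re (cnj l * l) = (norm l)\<^sup>2"
    by (simp add: cmod_power2 flip: power2_eq_square)
  moreover have "0 < (norm l)\<^sup>2"
    using \<open>l \<noteq> 0\<close> by simp
  ultimately have "\<forall>\<^sub>F s in at_right 0. (norm l)\<^sup>2 / 2 < Re (cnj l * a s)"
    by (intro order_tendstoD(1)) auto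
  then obtain d where "0 < d" and d: "\<And>s. 0 < s \<Longrightarrow> s < d \<Longrightarrow> (norm l)\<^sup>2 / 2 < Re (cnj l * a s)"
    unfolding eventually_at_right_field by auto
  define r where "r = min (d / 2) (1 / 2)"
  have r: "0 < r" "r \<le> 1/2" "r < d"
    using \<open>0 < d\<close> by (auto simp: r_def)
  show False
  proof (rule no_moderate_growth_if_steep)
    show "0 \<le> \<mu>" by (rule \<mu>_nonneg)
    show "0 < (norm l)\<^sup>2 / C" using \<open>l \<noteq> 0\<close> C_pos by simp
    show "0 < r" "r \<le> 1" using r by auto
    fix s assume "s \<in> {0<..r}"
    then have s: "s \<in> {0<..1/2}" "0 < s" "s < d" using r by auto
    have "((\<lambda>s. - Re (cnj l * b s)) has_vector_derivative - Re (cnj l * ((- 2 / q s) *\<^sub>R a s))) (at s)"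
      by (intro has_vector_derivative_minus bounded_linear.has_vector_derivative[OF bounded_linear_Re]
          has_vector_derivative_mult_right b_deriv s)
    then show "((\<lambda>s. - Re (cnj l * b s)) has_real_derivative 2 * Re (cnj l * a s) / q s) (at s)"
      by (simp add: has_real_derivative_iff_has_vector_derivative field_simps)
    have "(norm l)\<^sup>2 / C * s powr (- \<mu> - 1) = (norm l)\<^sup>2 * (1 / C * s powr (- \<mu> - 1))"
      by simp
    also have "\<dots> \<le> (2 * Re (cnj l * a s)) * (1 / q s)"
    proof (rule mult_mono)
      show "(norm l)\<^sup>2 \<le> 2 * Re (cnj l * a s)"
        using d[OF s(2,3)] by linarith
      then show "0 \<le> 2 * Re (cnj l * a s)"
        using zero_le_power2[of "norm l"] by linarith
    qed (use inverse_q_ge[OF s(1)] C_pos in auto)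
    finally show "(norm l)\<^sup>2 / C * s powr (- \<mu> - 1) \<le> 2 * Re (cnj l * a s) / q s"
      by simp
    have "\<bar>- Re (cnj l * b s)\<bar> \<le> norm l * norm (b s)"
      using abs_Re_le_cmod[of "cnj l * b s"] by (simp add: norm_mult)
    also have "\<dots> \<le> norm l * (K * s powr (- \<mu> / 2))"
      by (intro mult_left_mono b s) simp
    finally show "\<bar>- Re (cnj l * b s)\<bar> \<le> (norm l * K) * s powr (- \<mu> / 2)"
      by simp
  qed
qed

text \<open>
  If \<open>a\<close> tends to \<open>l \<noteq> 0\<close>, then \<open>|a|\<^sup>2/q\<close> is too large for its antiderivative to stay bounded.
\<close>

lemma limit_zero_if_square_integrable:
  assumes lim: "(a \<longlongrightarrow> l) (at_right 0)"
    and \<Phi>: "\<And>s. s \<in> {0<..1/2} \<Longrightarrow> (\<Phi> has_real_derivative f s) (at s)"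
    and \<Phi>_le: "\<And>s. s \<in> {0<..1/2} \<Longrightarrow> \<bar>\<Phi> s\<bar> \<le> M"
    and f_ge: "\<And>s. s \<in> {0<..1/2} \<Longrightarrow> (norm (a s))\<^sup>2 / q s \<le> f s"
  shows "l = 0"
proof (rule ccontr)
  assume "l \<noteq> 0"
  have "((\<lambda>s. (norm (a s))\<^sup>2) \<longlongrightarrow> (norm l)\<^sup>2) (at_right 0)"
    by (intro tendsto_intros lim)
  moreover have "0 < (norm l)\<^sup>2"
    using \<open>l \<noteq> 0\<close> by simp
  ultimately have "\<forall>\<^sub>F s in at_right 0. (norm l)\<^sup>2 / 2 < (norm (a s))\<^sup>2"
    by (intro order_tendstoD(1)) auto
  then obtain d where "0 < d" and d: "\<And>s. 0 < s \<Longrightarrow> s < d \<Longrightarrow> (norm l)\<^sup>2 / 2 < (norm (a s))\<^sup>2"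
    unfolding eventually_at_right_field by auto
  define r where "r = min (d / 2) (1 / 2)"
  have r: "0 < r" "r \<le> 1/2" "r < d"
    using \<open>0 < d\<close> by (auto simp: r_def)
  show False
  proof (rule no_moderate_growth_if_steep)
    show "0 \<le> \<mu>" by (rule \<mu>_nonneg)
    show "0 < (norm l)\<^sup>2 / 2 / C" using \<open>l \<noteq> 0\<close> C_pos by simp
    show "0 < r" "r \<le> 1" using r by auto
    fix s assume "s \<in> {0<..r}"
    then have s: "s \<in> {0<..1/2}" "0 < s" "s < d" using r by auto
    show "(\<Phi> has_real_derivative f s) (at s)"
      by (rule \<Phi>[OF s(1)])
    have "(norm l)\<^sup>2 / 2 / C * s powr (- \<mu> - 1) = (norm l)\<^sup>2 / 2 * (1 / C * s powr (- \<mu> - 1))"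
      by simp
    also have "\<dots> \<le> (norm (a s))\<^sup>2 * (1 / q s)"
      using d[OF s(2,3)] inverse_q_ge[OF s(1)] C_pos by (intro mult_mono) auto
    also have "\<dots> \<le> f s"
      using f_ge[OF s(1)] by simp
    finally show "(norm l)\<^sup>2 / 2 / C * s powr (- \<mu> - 1) \<le> f s" .
    have "1 \<le> s powr (- \<mu> / 2)"
      using powr_mono2'[of "- \<mu> / 2" s 1] \<mu>_nonneg s by simp
    moreover have "0 \<le> M"
      using \<Phi>_le[OF s(1)] by simp
    ultimately show "\<bar>\<Phi> s\<bar> \<le> M * s powr (- \<mu> / 2)"
      using \<Phi>_le[OF s(1)] mult_left_mono[of 1 "s powr (- \<mu> / 2)" M] by simp
  qed
qed

text \<open>
  The bound on \<open>b\<close> makes \<open>a'\<close> of order \<open>s\<close> to the power \<open>\<mu>/2\<close>. Since \<open>a\<close> vanishes at the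
  endpoint, integration gains one power.
\<close>

lemma decay_if_moderate:
  assumes b: "\<And>s. s \<in> {0<..1/2} \<Longrightarrow> norm (b s) \<le> K * s powr (- \<mu> / 2)"
  obtains K' where "\<And>s. s \<in> {0<..1/2} \<Longrightarrow> norm (a s) \<le> K' * s powr (\<mu> / 2 + 1)"
proof -
  define K' where "K' = C * C * K / (\<mu> / 2 + 1)"
  have e: "\<mu> / 2 + 1 \<noteq> 0" using \<mu>_nonneg by simp
  have \<phi>: "((\<lambda>s. K' * s powr (\<mu> / 2 + 1)) has_real_derivative C * C * K * s powr (\<mu> / 2)) (at s)"
    if "s \<in> {0<..1/2}" for s
  proof -
    have "((\<lambda>s. K' * s powr (\<mu> / 2 + 1)) has_real_derivative
        K' * ((\<mu> / 2 + 1) * s powr (\<mu> / 2 + 1 - 1))) (at s)"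
      using that by (intro DERIV_cmult has_real_derivative_powr) auto
    then show ?thesis using e by (simp add: K'_def mult.assoc)
  qed
  have a': "norm (a' s) \<le> C * C * K * s powr (\<mu> / 2)" if s: "s \<in> {0<..1/2}" for s
  proof -
    have "\<rho> s * norm (b s) \<le> (C * s powr \<mu>) * (K * s powr (- \<mu> / 2))"
      using \<rho>_le[OF s] \<rho>_nonneg[OF s] b[OF s] C_pos by (intro mult_mono) auto
    also have "\<dots> = C * K * (s powr \<mu> * s powr (- \<mu> / 2))"
      by simp
    also have "s powr \<mu> * s powr (- \<mu> / 2) = s powr (\<mu> / 2)"
      by (simp flip: powr_add)
    finally have "C * (\<rho> s * norm (b s)) \<le> C * (C * K * s powr (\<mu> / 2))"
      using C_pos by (intro mult_left_mono) auto
    with a'_le[OF s] show ?thesis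
      by (simp add: mult.assoc)
  qed
  have "((\<lambda>s. K' * s powr (\<mu> / 2 + 1)) \<longlongrightarrow> K' * 0) (at_right 0)"
    using \<mu>_nonneg by (intro tendsto_mult tendsto_const) real_asymp
  then obtain l where l: "(a \<longlongrightarrow> l) (at_right 0)"
      "\<And>s. s \<in> {0<..1/2} \<Longrightarrow> norm (a s - l) \<le> K' * s powr (\<mu> / 2 + 1)"
    using limit_at_zero_of_integrable_derivative[of "1/2" a a', OF _ a_deriv \<phi> a'] by auto
  have "l = 0"
    using l(1) b by (rule limit_zero_if_moderate)
  with l(2) show thesis by (intro that[of K']) simp
qed

text \<open>
  The antiderivative \<open>\<Phi>\<close> of \<open>f\<close> expresses the integrability of \<open>|a|\<^sup>2/q\<close> and \<open>\<rho>|b|\<^sup>2\<close>. The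
  Cauchy-Schwarz inequality bounds \<open>|a(s)|\<close>, which is at most a multiple of the integral of \<open>\<rho>|b|\<close>
  over \<open>(0,s)\<close>, by a multiple of \<open>s\<close> to the power \<open>(\<mu>+1)/2\<close>. Then \<open>b' = -2a/q\<close> is of order \<open>s\<close> to
  the power \<open>-\<mu>/2-1/2\<close>, and integrating it towards the endpoint bounds \<open>b\<close> by a multiple of \<open>s\<close>
  to the power \<open>-\<mu>/2\<close>. The Cauchy-Schwarz inequality appears as the family of majorants obtained from
  \<open>2|b| \<le> k + |b|\<^sup>2/k\<close> for all \<open>k > 0\<close>.
\<close>

lemma moderate_if_square_integrable:
  assumes \<Phi>: "\<And>s. s \<in> {0<..1/2} \<Longrightarrow> (\<Phi> has_real_derivative f s) (at s)"
    and \<Phi>_lim: "(\<Phi> \<longlongrightarrow> 0) (at_right 0)"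
    and \<Phi>_le: "\<And>s. s \<in> {0<..1/2} \<Longrightarrow> \<bar>\<Phi> s\<bar> \<le> M"
    and f_ge_a: "\<And>s. s \<in> {0<..1/2} \<Longrightarrow> (norm (a s))\<^sup>2 / q s \<le> f s"
    and f_ge_b: "\<And>s. s \<in> {0<..1/2} \<Longrightarrow> \<rho> s * (norm (b s))\<^sup>2 \<le> f s"
  obtains K where "\<And>s. s \<in> {0<..1/2} \<Longrightarrow> norm (b s) \<le> K * s powr (- \<mu> / 2)"
proof -
  define \<phi> where "\<phi> k s = C / 2 * (C * k / (\<mu> + 1) * s powr (\<mu> + 1) + \<Phi> s / k)" for k s
  define \<phi>' where "\<phi>' k s = C / 2 * (C * k * s powr \<mu> + f s / k)" for k s
  have \<phi>: "(\<phi> k has_real_derivative \<phi>' k s) (at s)" if "s \<in> {0<..1/2}" for k s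
  proof -
    have "((\<lambda>s. C * k / (\<mu> + 1) * s powr (\<mu> + 1)) has_real_derivative
        C * k / (\<mu> + 1) * ((\<mu> + 1) * s powr (\<mu> + 1 - 1))) (at s)"
      using that by (intro DERIV_cmult has_real_derivative_powr) auto
    then have "((\<lambda>s. C * k / (\<mu> + 1) * s powr (\<mu> + 1)) has_real_derivative C * k * s powr \<mu>) (at s)"
      using \<mu>_nonneg by (simp add: mult.assoc)
    then show ?thesis
      unfolding \<phi>_def \<phi>'_def by (intro DERIV_cmult DERIV_add DERIV_cdivide \<Phi> that)
  qed
  have a': "norm (a' s) \<le> \<phi>' k s" if s: "s \<in> {0<..1/2}" and "0 < k" for k s
  proof -
    have "norm (b s) \<le> (k + (norm (b s))\<^sup>2 / k) / 2"
      using \<open>0 < k\<close> sum_squares_bound[of k "norm (b s)"] by (simp add: field_simps power2_eq_square)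
    then have "\<rho> s * norm (b s) \<le> \<rho> s * ((k + (norm (b s))\<^sup>2 / k) / 2)"
      using \<rho>_nonneg[OF s] by (intro mult_left_mono)
    also have "\<dots> = (k * \<rho> s + (\<rho> s * (norm (b s))\<^sup>2) / k) / 2"
      by (simp add: algebra_simps)
    also have "\<dots> \<le> (k * (C * s powr \<mu>) + f s / k) / 2"
      using \<rho>_le[OF s] f_ge_b[OF s] \<open>0 < k\<close>
      by (intro divide_right_mono add_mono mult_left_mono) auto
    finally show ?thesis
      using a'_le[OF s] C_pos mult_left_mono[of "\<rho> s * norm (b s)" "(k * (C * s powr \<mu>) + f s / k) / 2" C]
      by (simp add: \<phi>'_def algebra_simps)
  qed
  have \<phi>_lim: "(\<phi> k \<longlongrightarrow> 0) (at_right 0)" if "0 < k" for k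
  proof -
    have "((\<lambda>s. s powr (\<mu> + 1)) \<longlongrightarrow> 0) (at_right 0)"
      using \<mu>_nonneg by real_asymp
    then have "(\<phi> k \<longlongrightarrow> C / 2 * (C * k / (\<mu> + 1) * 0 + 0 / k)) (at_right 0)"
      unfolding \<phi>_def using that by (intro tendsto_intros \<Phi>_lim) auto
    then show ?thesis by simp
  qed
  have a_le: "norm (a s) \<le> \<phi> k s" if s: "s \<in> {0<..1/2}" and "0 < k" for k s
  proof -
    obtain l where l: "(a \<longlongrightarrow> l) (at_right 0)"
      "\<And>s. s \<in> {0<..1/2} \<Longrightarrow> norm (a s - l) \<le> \<phi> k s"
      using limit_at_zero_of_integrable_derivative[of "1/2" a a', OF _ a_deriv \<phi> a' \<phi>_lim] \<open>0 < k\<close>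
      by auto
    have "l = 0"
      using l(1) \<Phi> \<Phi>_le f_ge_a by (rule limit_zero_if_square_integrable)
    with l(2)[OF s] show ?thesis by simp
  qed
  define A where "A = C / 2 * (C / (\<mu> + 1) + M)"
  have a_le': "norm (a s) \<le> A * s powr ((\<mu> + 1) / 2)" if s: "s \<in> {0<..1/2}" for s
  proof -
    \<comment> \<open>This \<open>k\<close> balances the two terms of \<open>\<phi> k s\<close>.\<close>
    define k where "k = s powr (- (\<mu> + 1) / 2)"
    have k: "0 < k" "k * s powr (\<mu> + 1) = s powr ((\<mu> + 1) / 2)" "1 / k = s powr ((\<mu> + 1) / 2)"
      using s unfolding k_def by (auto simp: powr_minus field_simps simp flip: powr_add)
    have "norm (a s) \<le> C / 2 * (C / (\<mu> + 1) * (k * s powr (\<mu> + 1)) + \<Phi> s * (1 / k))"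
      using a_le[OF s k(1)] by (simp add: \<phi>_def mult.assoc)
    also have "\<dots> = C / 2 * (C / (\<mu> + 1) + \<Phi> s) * s powr ((\<mu> + 1) / 2)"
      unfolding k by (simp add: algebra_simps)
    also have "\<dots> \<le> A * s powr ((\<mu> + 1) / 2)"
      unfolding A_def using \<Phi>_le[OF s] C_pos
      by (intro mult_right_mono mult_left_mono add_left_mono) auto
    finally show ?thesis .
  qed
  have "0 \<le> A * (1/2) powr ((\<mu> + 1) / 2)"
    using order_trans[OF norm_ge_zero a_le'[of "1/2"]] by simp
  then have "0 \<le> A"
    by (simp add: zero_le_mult_iff)
  define B where "B = 2 * A / c"
  have b': "norm ((- 2 / q t) *\<^sub>R a t) \<le> B * t powr (- (\<mu> + 1) / 2)" if t: "t \<in> {0<..1/2}" for t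
  proof -
    have "norm ((- 2 / q t) *\<^sub>R a t) = 2 * (norm (a t) / q t)"
      using q_pos[OF t] by simp
    also have "norm (a t) / q t \<le> A * t powr ((\<mu> + 1) / 2) / (c * t powr (\<mu> + 1))"
      using a_le'[OF t] q_ge[OF t] t c_pos \<open>0 \<le> A\<close> by (intro frac_le) auto
    also have "\<dots> = A / c * (t powr ((\<mu> + 1) / 2) * t powr (- (\<mu> + 1)))"
      by (simp only: powr_minus) (simp add: field_simps)
    also have "t powr ((\<mu> + 1) / 2) * t powr (- (\<mu> + 1)) = t powr (- (\<mu> + 1) / 2)"
      by (simp flip: powr_add add: field_simps)
    finally show ?thesis
      by (simp add: B_def)
  qed
  have "norm (b s) \<le> (2 * B + norm (b (1/2))) * s powr (- \<mu> / 2)" if s: "s \<in> {0<..1/2}" for s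
  proof -
    define S where "S = s powr (- \<mu> / 2)"
    have S: "0 \<le> B * S" using \<open>0 \<le> A\<close> c_pos by (simp add: B_def S_def)
    have "1 \<le> S"
      using powr_mono2'[of "- \<mu> / 2" s 1] \<mu>_nonneg s by (simp add: S_def)
    \<comment> \<open>On \<open>[s,1/2]\<close> the factor \<open>t\<close> to the power \<open>-\<mu>/2\<close> of the bound on \<open>b'\<close> is at most its value \<open>S\<close> at \<open>s\<close>, and the remaining factor \<open>1 / sqrt t\<close> has a bounded antiderivative. This avoids a case distinction on \<open>\<mu>\<close>.\<close>
    have diff: "norm (b (1/2) - b s) \<le> 2 * B * S * sqrt (1/2) - 2 * B * S * sqrt s"
    proof (cases "s = 1/2")
      case True
      show ?thesis unfolding True by simp
    next
      case False
      show ?thesis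
      proof (rule differentiable_bound_general[where f' = "\<lambda>t. (- 2 / q t) *\<^sub>R a t"
            and \<phi>' = "\<lambda>t. B * S / sqrt t"])
        show "s < 1/2" using s False by simp
        show "continuous_on {s..1/2} b"
          using s by (intro continuous_at_imp_continuous_on ballI
            has_vector_derivative_continuous[OF b_deriv]) auto
        show "continuous_on {s..1/2} (\<lambda>t. 2 * B * S * sqrt t)"
          by (intro continuous_intros)
        fix t assume t: "s < t" "t < 1/2"
        then have t': "t \<in> {0<..1/2}" using s by auto
        show "(b has_vector_derivative (- 2 / q t) *\<^sub>R a t) (at t)"
          by (rule b_deriv[OF t'])
        show "((\<lambda>t. 2 * B * S * sqrt t) has_vector_derivative B * S / sqrt t) (at t)"
          unfolding has_real_derivative_iff_has_vector_derivative[symmetric]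
          using t' by (auto intro!: derivative_eq_intros simp: field_simps)
        have "t powr (- (\<mu> + 1) / 2) = t powr (- \<mu> / 2) * t powr (- (1/2))"
          by (simp flip: powr_add add: field_simps)
        also have "\<dots> = t powr (- \<mu> / 2) / sqrt t"
          using t' by (simp add: powr_minus powr_half_sqrt field_simps)
        also have "\<dots> \<le> S / sqrt t"
          using powr_mono2'[of "- \<mu> / 2" s t] \<mu>_nonneg s t unfolding S_def
          by (intro divide_right_mono) auto
        finally have "B * t powr (- (\<mu> + 1) / 2) \<le> B * (S / sqrt t)"
          using \<open>0 \<le> A\<close> c_pos by (intro mult_left_mono) (auto simp: B_def)
        then show "norm ((- 2 / q t) *\<^sub>R a t) \<le> B * S / sqrt t"
          using b'[OF t'] by simp
      qed
    qed
    have "norm (b s) \<le> norm (b (1/2)) + norm (b (1/2) - b s)"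
      by (metis norm_minus_commute norm_triangle_sub)
    also have "norm (b (1/2) - b s) \<le> 2 * B * S * sqrt (1/2)"
    proof -
      have "0 \<le> B * S * sqrt s"
        using S s mult_nonneg_nonneg[of "B * S" "sqrt s"] by simp
      with diff show ?thesis by (simp add: mult.assoc)
    qed
    also have "\<dots> \<le> 2 * B * S * 1"
      using S by (intro mult_left_mono) (auto simp: real_le_lsqrt)
    also have "norm (b (1/2)) \<le> norm (b (1/2)) * S"
      using \<open>1 \<le> S\<close> mult_left_mono[of 1 S "norm (b (1/2))"] by simp
    finally show ?thesis
      by (simp add: S_def algebra_simps)
  qed
  with that show thesis by blast
qed

end

section \<open>The canonical system on the unit interval\<close>

text \<open>
  The next four lemmas exchange the distance \<open>s\<close> from the nearer endpoint for \<open>z(1-z)\<close>, which treats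
  both endpoints alike; here \<open>1 - s\<close> lies between \<open>1/2\<close> and \<open>1\<close>.
\<close>

lemma powr_le_symmetric:
  fixes s e :: real
  assumes "s \<in> {0<..1/2}" "0 \<le> e"
  shows "s powr e \<le> 2 powr e * (s * (1 - s)) powr e"
proof -
  have "s \<le> 2 * (s * (1 - s))"
    using mult_left_mono[of "1 / 2" "1 - s" s] assms by simp
  then have "s powr e \<le> (2 * (s * (1 - s))) powr e"
    using assms by (intro powr_mono2) auto
  then show ?thesis using assms by (simp add: powr_mult)
qed

lemma symmetric_le_powr:
  fixes s e :: real
  assumes "s \<in> {0<..1/2}" "0 \<le> e"
  shows "(s * (1 - s)) powr e \<le> s powr e"
  using assms mult_left_mono[of "1 - s" 1 s] by (intro powr_mono2) auto

lemma powr_minus_le_symmetric: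
  fixes s e :: real
  assumes "s \<in> {0<..1/2}" "0 \<le> e"
  shows "s powr - e \<le> (s * (1 - s)) powr - e"
  using assms mult_left_mono[of "1 - s" 1 s] by (intro powr_mono2') auto

lemma symmetric_le_powr_minus:
  fixes s e :: real
  assumes "s \<in> {0<..1/2}" "0 \<le> e"
  shows "(s * (1 - s)) powr - e \<le> 2 powr e * s powr - e"
proof -
  have "s / 2 \<le> s * (1 - s)"
    using mult_left_mono[of "1 / 2" "1 - s" s] assms by simp
  then have "(s * (1 - s)) powr - e \<le> (s / 2) powr - e"
    using assms by (intro powr_mono2') auto
  then show ?thesis using assms by (simp add: powr_divide powr_minus field_simps)
qed

text \<open>
  Restates integrability in the form in which the endpoint analysis uses it, with limits at both
  endpoints for the two instances of that analysis.
\<close>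

lemma antiderivative_if_integrable:
  fixes f :: "real \<Rightarrow> real"
  assumes f: "f integrable_on {0<..<1}" and cont: "continuous_on {0<..<1} f"
  obtains F B where "\<And>z. z \<in> {0<..<1} \<Longrightarrow> (F has_real_derivative f z) (at z)"
    and "(F \<longlongrightarrow> F 0) (at_right 0)" and "((\<lambda>s. F (1 - s)) \<longlongrightarrow> F 1) (at_right 0)"
    and "\<And>z. z \<in> {0..1} \<Longrightarrow> \<bar>F z\<bar> \<le> B"
proof -
  define F where "F z = integral {0..z} f" for z
  have int: "f integrable_on {0..1}"
    using f by (simp add: integrable_on_Icc_iff_Ioo)
  then have F: "continuous_on {0..1} F"
    unfolding F_def by (rule indefinite_integral_continuous_1)
  have "(F has_real_derivative f z) (at z)" if "z \<in> {0<..<1}" for z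
  proof -
    have "isCont f z"
      using cont that by (simp add: continuous_on_eq_continuous_at)
    then have "(F has_vector_derivative f z) (at z within {0..1} - {})"
      unfolding F_def using that int
      by (intro integral_has_vector_derivative_continuous_at) (auto intro: continuous_at_imp_continuous_at_within)
    moreover have "at z within {0..1} - {} = at z"
      using that by (intro at_within_interior) auto
    ultimately show ?thesis
      by (simp add: has_real_derivative_iff_has_vector_derivative)
  qed
  moreover have right: "(F \<longlongrightarrow> F 0) (at_right 0)"
    using F by (auto simp: continuous_on_def at_within_Icc_at_right dest!: bspec[of _ _ 0])
  moreover have "((\<lambda>s. F (1 - s)) \<longlongrightarrow> F 1) (at_right 0)"
  proof -
    have "continuous_on {0..1} (\<lambda>s. F (1 - s))"
      by (rule continuous_on_compose2[OF F]) (auto intro!: continuous_intros)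
    then show ?thesis
      by (auto simp: continuous_on_def at_within_Icc_at_right dest!: bspec[of _ _ 0])
  qed
  moreover obtain B where "\<And>z. z \<in> {0..1} \<Longrightarrow> \<bar>F z\<bar> \<le> B"
  proof -
    have "bounded (F ` {0..1})"
      by (intro compact_imp_bounded compact_continuous_image F) auto
    then obtain B where "\<forall>y\<in>F ` {0..1}. norm y \<le> B"
      unfolding bounded_iff by auto
    then show thesis by (intro that[of B]) auto
  qed
  ultimately show thesis using that by blast
qed

lemma has_vector_derivative_affine:
  fixes f :: "real \<Rightarrow> 'a::real_normed_vector"
  assumes "(f has_vector_derivative f') (at (s * x + t))"
  shows "((\<lambda>x. f (s * x + t)) has_vector_derivative s *\<^sub>R f') (at x)"
proof -
  have "((\<lambda>x. s * x + t) has_vector_derivative s) (at x)"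
    by (auto intro!: derivative_eq_intros)
  from vector_diff_chain_at[OF this assms] show ?thesis
    by (simp add: o_def)
qed

lemma has_vector_derivative_reflect:
  fixes f :: "real \<Rightarrow> 'a::real_normed_vector"
  assumes "(f has_vector_derivative f') (at (1 - s))"
  shows "((\<lambda>s. f (1 - s)) has_vector_derivative - f') (at s)"
  using has_vector_derivative_affine[of f f' "- 1" s 1] assms by simp

locale coulomb_parameters =
  fixes \<mu> u1 u2 u3 :: real
  assumes \<mu>_nonneg: "0 \<le> \<mu>"
begin

definition q :: "real \<Rightarrow> real" where
  "q z = (z * (1 - z)) powr (\<mu> + 1) * exp (- 4 * u2 * z)"

definition g :: "real \<Rightarrow> real" where
  "g z = u3 / z + 2 * (u1 + u2\<^sup>2)"

text \<open>
  Satisfied by \<open>a = py\<^sub>1\<close> and \<open>b = y\<^sub>2/p\<close> when \<open>Jy' = Hy\<close> and \<open>p\<close> is the positive square root of \<open>q\<close>.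
\<close>

definition canonical_system :: "(real \<Rightarrow> complex) \<Rightarrow> (real \<Rightarrow> complex) \<Rightarrow> bool" where
  "canonical_system a b \<longleftrightarrow>
     (\<forall>z\<in>{0<..<1}. (a has_vector_derivative (g z * q z) *\<^sub>R b z) (at z) \<and>
                   (b has_vector_derivative (- 2 / q z) *\<^sub>R a z) (at z))"

text \<open>
  The integrand \<open>y\<^sup>* W y\<close> of the weighted space, expressed through \<open>a\<close> and \<open>b\<close>.
\<close>

definition energy_density :: "(real \<Rightarrow> complex) \<Rightarrow> (real \<Rightarrow> complex) \<Rightarrow> real \<Rightarrow> real" where
  "energy_density a b z = (norm (a z))\<^sup>2 / (q z * (1 - z)) + q z * (norm (b z))\<^sup>2 / z"

lemma q_pos: "z \<in> {0<..<1} \<Longrightarrow> 0 < q z"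
  by (simp add: q_def)

lemma q_bounds:
  assumes "z \<in> {0<..<1}"
  shows "exp (- 4 * \<bar>u2\<bar>) * (z * (1 - z)) powr (\<mu> + 1) \<le> q z"
    and "q z \<le> exp (4 * \<bar>u2\<bar>) * (z * (1 - z)) powr (\<mu> + 1)"
proof -
  have "\<bar>u2 * z\<bar> \<le> \<bar>u2\<bar>"
    using assms mult_left_le[of z "\<bar>u2\<bar>"] by (simp add: abs_mult)
  then have "- 4 * \<bar>u2\<bar> \<le> - 4 * u2 * z" "- 4 * u2 * z \<le> 4 * \<bar>u2\<bar>"
    by (auto simp: abs_le_iff)
  then show "exp (- 4 * \<bar>u2\<bar>) * (z * (1 - z)) powr (\<mu> + 1) \<le> q z"
    "q z \<le> exp (4 * \<bar>u2\<bar>) * (z * (1 - z)) powr (\<mu> + 1)"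
    unfolding q_def by (simp_all add: mult.commute[of "exp _"] mult_left_mono)
qed

lemma continuous_on_q: "continuous_on {0<..<1} q"
  unfolding q_def by (intro continuous_intros) auto

lemma canonical_systemD:
  assumes "canonical_system a b" "z \<in> {0<..<1}"
  shows "(a has_vector_derivative (g z * q z) *\<^sub>R b z) (at z)"
    and "(b has_vector_derivative (- 2 / q z) *\<^sub>R a z) (at z)"
  using assms unfolding canonical_system_def by auto

lemma canonical_system_continuous:
  assumes "canonical_system a b"
  shows "continuous_on {0<..<1} a" "continuous_on {0<..<1} b"
proof -
  have "isCont a z" "isCont b z" if "z \<in> {0<..<1}" for z
    using canonical_systemD[OF assms that] by (blast intro: has_vector_derivative_continuous)+
  then show "continuous_on {0<..<1} a" "continuous_on {0<..<1} b"
    by (auto intro: continuous_at_imp_continuous_on)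
qed

lemma continuous_on_energy_density:
  assumes "canonical_system a b"
  shows "continuous_on {0<..<1} (energy_density a b)"
  unfolding energy_density_def using q_pos
  by (intro continuous_intros canonical_system_continuous[OF assms] continuous_on_q)
    (auto simp: less_imp_neq[symmetric])

text \<open>
  These two constants serve for all bounds at both endpoints. The power of \<open>2\<close> comes from the
  factor \<open>1 - s\<close>, the exponentials from \<open>exp(-4u\<^sub>2z)\<close>, and \<open>|u\<^sub>3| + 2|u\<^sub>1 + u\<^sub>2\<^sup>2|\<close> bounds \<open>zg(z)\<close>.
\<close>

definition lower :: real where "lower = exp (- 4 * \<bar>u2\<bar>) / 2 powr (\<mu> + 1)"

definition upper :: real where "upper = 2 * exp (4 * \<bar>u2\<bar>) + \<bar>u3\<bar> + 2 * \<bar>u1 + u2\<^sup>2\<bar>"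

lemma lower_pos: "0 < lower" and upper_pos: "0 < upper"
  by (simp_all add: lower_def upper_def add_pos_nonneg)

lemma q_endpoint_bounds:
  assumes s: "s \<in> {0<..1/2}" and z: "z = s \<or> z = 1 - s"
  shows "lower * s powr (\<mu> + 1) \<le> q z" "q z \<le> upper * s powr (\<mu> + 1)"
    "q z / z \<le> upper * s powr \<mu>" "\<bar>g z * q z\<bar> \<le> upper * (q z / z)"
proof -
  have z': "z \<in> {0<..<1}" "z * (1 - z) = s * (1 - s)" "s \<le> z"
    using s z by auto
  have e: "0 \<le> \<mu> + 1" using \<mu>_nonneg by simp
  have "lower * s powr (\<mu> + 1) \<le> lower * (2 powr (\<mu> + 1) * (s * (1 - s)) powr (\<mu> + 1))"
    using lower_pos by (intro mult_left_mono powr_le_symmetric s e) auto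
  also have "\<dots> \<le> q z"
    using q_bounds(1)[OF z'(1)] z'(2) by (simp add: lower_def)
  finally show "lower * s powr (\<mu> + 1) \<le> q z" .
  have q_le: "q z \<le> exp (4 * \<bar>u2\<bar>) * s powr (\<mu> + 1)"
  proof -
    have "q z \<le> exp (4 * \<bar>u2\<bar>) * (s * (1 - s)) powr (\<mu> + 1)"
      using q_bounds(2)[OF z'(1)] z'(2) by simp
    also have "\<dots> \<le> exp (4 * \<bar>u2\<bar>) * s powr (\<mu> + 1)"
      by (intro mult_left_mono symmetric_le_powr s e) auto
    finally show ?thesis .
  qed
  also have "\<dots> \<le> upper * s powr (\<mu> + 1)"
    by (intro mult_right_mono) (auto simp: upper_def intro: add_nonneg_nonneg)
  finally show "q z \<le> upper * s powr (\<mu> + 1)" .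
  have "q z / z \<le> exp (4 * \<bar>u2\<bar>) * s powr (\<mu> + 1) / s"
    using q_le z' s q_pos[OF z'(1)] by (intro frac_le) auto
  also have "\<dots> = exp (4 * \<bar>u2\<bar>) * s powr \<mu>"
    using s by (simp add: powr_add)
  also have "\<dots> \<le> upper * s powr \<mu>"
    by (intro mult_right_mono) (auto simp: upper_def intro: add_nonneg_nonneg)
  finally show "q z / z \<le> upper * s powr \<mu>" .
  have "\<bar>g z * q z\<bar> = \<bar>u3 + 2 * (u1 + u2\<^sup>2) * z\<bar> * (q z / z)"
  proof -
    have "g z * q z = (u3 + 2 * (u1 + u2\<^sup>2) * z) * (q z / z)"
      using z'(1) by (simp add: g_def field_simps)
    then show ?thesis
      using q_pos[OF z'(1)] z'(1) by (simp add: abs_mult)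
  qed
  also have "\<dots> \<le> upper * (q z / z)"
  proof (rule mult_right_mono)
    have "\<bar>u3 + 2 * (u1 + u2\<^sup>2) * z\<bar> \<le> \<bar>u3\<bar> + 2 * \<bar>u1 + u2\<^sup>2\<bar> * z"
    proof -
      have "\<bar>2 * (u1 + u2\<^sup>2) * z\<bar> = 2 * \<bar>u1 + u2\<^sup>2\<bar> * z"
        using z'(1) unfolding abs_mult by simp
      then show ?thesis
        using abs_triangle_ineq[of u3 "2 * (u1 + u2\<^sup>2) * z"] by linarith
    qed
    also have "\<dots> \<le> \<bar>u3\<bar> + 2 * \<bar>u1 + u2\<^sup>2\<bar> * 1"
      using z'(1) by (intro add_left_mono mult_left_mono) auto
    finally show "\<bar>u3 + 2 * (u1 + u2\<^sup>2) * z\<bar> \<le> upper"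
      unfolding upper_def by (smt (verit) exp_gt_zero)
    show "0 \<le> q z / z"
      using q_pos[OF z'(1)] z'(1) by simp
  qed
  finally show "\<bar>g z * q z\<bar> \<le> upper * (q z / z)" .
qed

lemma singular_endpoint_left:
  assumes "canonical_system a b"
  shows "singular_endpoint \<mu> lower upper q (\<lambda>s. q s / s) a (\<lambda>s. (g s * q s) *\<^sub>R b s) b"
proof
  fix s :: real assume s: "s \<in> {0<..1/2}"
  then have s': "s \<in> {0<..<1}" by auto
  note B = q_endpoint_bounds[OF s disjI1[OF refl]]
  show "lower * s powr (\<mu> + 1) \<le> q s" "q s \<le> upper * s powr (\<mu> + 1)" "q s / s \<le> upper * s powr \<mu>"
    by (rule B)+
  show "norm ((g s * q s) *\<^sub>R b s) \<le> upper * (q s / s * norm (b s))"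
    using mult_right_mono[OF B(4) norm_ge_zero[of "b s"]] by (simp add: mult.assoc)
  show "0 \<le> q s / s" using q_pos[OF s'] s' by simp
qed (use canonical_systemD[OF assms] in \<open>auto simp: \<mu>_nonneg lower_pos upper_pos\<close>)

text \<open>
  Reflection flips the sign of both derivatives. Replacing \<open>b\<close> by \<open>-b\<close> restores the second equation,
  and \<open>singular_endpoint\<close> leaves the sign of the first open.
\<close>

lemma singular_endpoint_right:
  assumes "canonical_system a b"
  shows "singular_endpoint \<mu> lower upper (\<lambda>s. q (1 - s)) (\<lambda>s. q (1 - s) / (1 - s))
    (\<lambda>s. a (1 - s)) (\<lambda>s. - ((g (1 - s) * q (1 - s)) *\<^sub>R b (1 - s))) (\<lambda>s. - b (1 - s))"
proof
  fix s :: real assume s: "s \<in> {0<..1/2}"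
  then have s': "1 - s \<in> {0<..<1}" by auto
  note B = q_endpoint_bounds[OF s disjI2[OF refl]]
  show "lower * s powr (\<mu> + 1) \<le> q (1 - s)" "q (1 - s) \<le> upper * s powr (\<mu> + 1)"
    "q (1 - s) / (1 - s) \<le> upper * s powr \<mu>"
    by (rule B)+
  show "norm (- ((g (1 - s) * q (1 - s)) *\<^sub>R b (1 - s))) \<le> upper * (q (1 - s) / (1 - s) * norm (- b (1 - s)))"
    using mult_right_mono[OF B(4) norm_ge_zero[of "b (1 - s)"]] by (simp add: mult.assoc)
  show "0 \<le> q (1 - s) / (1 - s)" using q_pos[OF s'] s' by simp
  show "((\<lambda>s. a (1 - s)) has_vector_derivative - ((g (1 - s) * q (1 - s)) *\<^sub>R b (1 - s))) (at s)"
    by (intro has_vector_derivative_reflect canonical_systemD(1)[OF assms s'])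
  have "((\<lambda>s. - b (1 - s)) has_vector_derivative - (- ((- 2 / q (1 - s)) *\<^sub>R a (1 - s)))) (at s)"
    by (intro has_vector_derivative_minus has_vector_derivative_reflect canonical_systemD(2)[OF assms s'])
  then show "((\<lambda>s. - b (1 - s)) has_vector_derivative (- 2 / q (1 - s)) *\<^sub>R a (1 - s)) (at s)"
    by simp
qed (auto simp: \<mu>_nonneg lower_pos upper_pos)

lemma energy_density_ge:
  assumes "z \<in> {0<..<1}"
  shows "(norm (a z))\<^sup>2 / q z \<le> energy_density a b z"
    and "q z / z * (norm (b z))\<^sup>2 \<le> energy_density a b z"
proof -
  have q: "0 < q z" using q_pos[OF assms] .
  have "(norm (a z))\<^sup>2 / q z \<le> (norm (a z))\<^sup>2 / (q z * (1 - z))"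
    using assms q mult_left_le[of "1 - z" "q z"] by (intro divide_left_mono) auto
  moreover have "0 \<le> q z * (norm (b z))\<^sup>2 / z" "0 \<le> (norm (a z))\<^sup>2 / (q z * (1 - z))"
    using assms q by auto
  ultimately show "(norm (a z))\<^sup>2 / q z \<le> energy_density a b z"
    "q z / z * (norm (b z))\<^sup>2 \<le> energy_density a b z"
    unfolding energy_density_def by auto
qed

text \<open>
  At the two endpoints, apply the endpoint analysis with the antiderivatives \<open>F(s) - F(0)\<close> and
  \<open>F(1) - F(1-s)\<close> of the energy density.
\<close>

lemma moderate_if_energy_integrable:
  assumes sys: "canonical_system a b" and int: "energy_density a b integrable_on {0<..<1}"
  obtains K where "\<And>z. z \<in> {0<..<1} \<Longrightarrow> norm (b z) \<le> K * (z * (1 - z)) powr (- \<mu> / 2)"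
proof -
  interpret left: singular_endpoint \<mu> lower upper q "\<lambda>s. q s / s" a "\<lambda>s. (g s * q s) *\<^sub>R b s" b
    by (rule singular_endpoint_left[OF sys])
  interpret right: singular_endpoint \<mu> lower upper "\<lambda>s. q (1 - s)" "\<lambda>s. q (1 - s) / (1 - s)"
    "\<lambda>s. a (1 - s)" "\<lambda>s. - ((g (1 - s) * q (1 - s)) *\<^sub>R b (1 - s))" "\<lambda>s. - b (1 - s)"
    by (rule singular_endpoint_right[OF sys])
  let ?f = "energy_density a b"
  obtain F B where F: "\<And>z. z \<in> {0<..<1} \<Longrightarrow> (F has_real_derivative ?f z) (at z)"
    and lim: "(F \<longlongrightarrow> F 0) (at_right 0)" "((\<lambda>s. F (1 - s)) \<longlongrightarrow> F 1) (at_right 0)"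
    and B: "\<And>z. z \<in> {0..1} \<Longrightarrow> \<bar>F z\<bar> \<le> B"
    using antiderivative_if_integrable[OF int continuous_on_energy_density[OF sys]] by blast
  have half: "s \<in> {0<..<1}" "1 - s \<in> {0<..<1}" if "s \<in> {0<..1/2}" for s :: real
    using that by auto
  obtain K1 where K1: "\<And>s. s \<in> {0<..1/2} \<Longrightarrow> norm (b s) \<le> K1 * s powr (- \<mu> / 2)"
  proof (rule left.moderate_if_square_integrable)
    fix s :: real assume s: "s \<in> {0<..1/2}"
    have "((\<lambda>s. F s - F 0) has_real_derivative ?f s - 0) (at s)"
      by (intro DERIV_diff DERIV_const F half s)
    then show "((\<lambda>s. F s - F 0) has_real_derivative ?f s) (at s)" by simp
    show "\<bar>F s - F 0\<bar> \<le> 2 * B"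
      using B[of s] B[of 0] s by auto
  next
    have "((\<lambda>s. F s - F 0) \<longlongrightarrow> F 0 - F 0) (at_right 0)"
      by (intro tendsto_intros lim)
    then show "((\<lambda>s. F s - F 0) \<longlongrightarrow> 0) (at_right 0)" by simp
  qed (use energy_density_ge half in auto)
  obtain K2 where K2: "\<And>s. s \<in> {0<..1/2} \<Longrightarrow> norm (- b (1 - s)) \<le> K2 * s powr (- \<mu> / 2)"
  proof (rule right.moderate_if_square_integrable)
    fix s :: real assume s: "s \<in> {0<..1/2}"
    have "((\<lambda>s. F (1 - s)) has_vector_derivative - ?f (1 - s)) (at s)"
      using F[OF half(2)[OF s]]
      by (intro has_vector_derivative_reflect) (simp add: has_real_derivative_iff_has_vector_derivative)
    then have "((\<lambda>s. F 1 - F (1 - s)) has_real_derivative 0 - (- ?f (1 - s))) (at s)"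
      by (intro DERIV_diff DERIV_const) (simp add: has_real_derivative_iff_has_vector_derivative)
    then show "((\<lambda>s. F 1 - F (1 - s)) has_real_derivative ?f (1 - s)) (at s)" by simp
    show "\<bar>F 1 - F (1 - s)\<bar> \<le> 2 * B"
      using B[of 1] B[of "1 - s"] s by auto
  next
    have "((\<lambda>s. F 1 - F (1 - s)) \<longlongrightarrow> F 1 - F 1) (at_right 0)"
      by (intro tendsto_intros lim)
    then show "((\<lambda>s. F 1 - F (1 - s)) \<longlongrightarrow> 0) (at_right 0)" by simp
  qed (use energy_density_ge half in auto)
  define K where "K = max 0 (max K1 K2)"
  have "norm (b z) \<le> K * (z * (1 - z)) powr (- \<mu> / 2)" if "z \<in> {0<..<1}" for z
  proof -
    define s where "s = min z (1 - z)"
    have s: "s \<in> {0<..1/2}" "s = z \<or> s = 1 - z" "s * (1 - s) = z * (1 - z)"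
      using that by (auto simp: s_def min_def)
    have "norm (b z) \<le> K * s powr (- \<mu> / 2)"
    proof -
      have "norm (b z) \<le> K1 * s powr (- \<mu> / 2) \<or> norm (b z) \<le> K2 * s powr (- \<mu> / 2)"
        using K1[OF s(1)] K2[OF s(1)] s(2) by auto
      moreover have "K1 * s powr (- \<mu> / 2) \<le> K * s powr (- \<mu> / 2)" "K2 * s powr (- \<mu> / 2) \<le> K * s powr (- \<mu> / 2)"
        by (auto simp: K_def intro!: mult_right_mono)
      ultimately show ?thesis by linarith
    qed
    also have "\<dots> \<le> K * (s * (1 - s)) powr (- \<mu> / 2)"
      using powr_minus_le_symmetric[OF s(1), of "\<mu> / 2"] \<mu>_nonneg
      by (intro mult_left_mono) (auto simp: K_def)
    finally show ?thesis by (simp add: s(3))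
  qed
  with that show thesis by blast
qed

text \<open>
  With \<open>r = z(1-z)\<close>, the bounds \<open>|a|\<^sup>2 = O(r\<^sup>\<mu>\<^sup>+\<^sup>2)\<close> and \<open>|b|\<^sup>2 = O(r\<close> to the power \<open>-\<mu>)\<close>
  leave a factor \<open>r\<close> in \<open>|a|\<^sup>2/q\<close> and in \<open>q|b|\<^sup>2\<close>, which absorbs the singular weights
  \<open>1/(1-z)\<close> and \<open>1/z\<close>.
\<close>

lemma energy_bounded_if_moderate:
  assumes sys: "canonical_system a b"
    and b: "\<And>z. z \<in> {0<..<1} \<Longrightarrow> norm (b z) \<le> K * (z * (1 - z)) powr (- \<mu> / 2)"
  obtains B where "\<And>z. z \<in> {0<..<1} \<Longrightarrow> energy_density a b z \<le> B"
proof -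
  interpret left: singular_endpoint \<mu> lower upper q "\<lambda>s. q s / s" a "\<lambda>s. (g s * q s) *\<^sub>R b s" b
    by (rule singular_endpoint_left[OF sys])
  interpret right: singular_endpoint \<mu> lower upper "\<lambda>s. q (1 - s)" "\<lambda>s. q (1 - s) / (1 - s)"
    "\<lambda>s. a (1 - s)" "\<lambda>s. - ((g (1 - s) * q (1 - s)) *\<^sub>R b (1 - s))" "\<lambda>s. - b (1 - s)"
    by (rule singular_endpoint_right[OF sys])
  have "0 \<le> K * (1/2 * (1 - 1/2)) powr (- \<mu> / 2)"
    using order_trans[OF norm_ge_zero b[of "1/2"]] by simp
  then have K: "0 \<le> K"
    by (simp add: zero_le_mult_iff)
  have half: "s \<in> {0<..<1}" "1 - s \<in> {0<..<1}" if "s \<in> {0<..1/2}" for s :: real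
    using that by auto
  have b': "K * (s * (1 - s)) powr (- \<mu> / 2) \<le> (K * 2 powr (\<mu> / 2)) * s powr (- \<mu> / 2)"
    if "s \<in> {0<..1/2}" for s
    using mult_left_mono[OF symmetric_le_powr_minus[OF that, of "\<mu> / 2"] K] \<mu>_nonneg
    by (simp add: mult.assoc)
  obtain K1 where K1: "\<And>s. s \<in> {0<..1/2} \<Longrightarrow> norm (a s) \<le> K1 * s powr (\<mu> / 2 + 1)"
  proof (rule left.decay_if_moderate)
    show "norm (b s) \<le> (K * 2 powr (\<mu> / 2)) * s powr (- \<mu> / 2)" if "s \<in> {0<..1/2}" for s
      using b[OF half(1)[OF that]] b'[OF that] by (rule order_trans)
  qed (rule that)
  obtain K2 where K2: "\<And>s. s \<in> {0<..1/2} \<Longrightarrow> norm (a (1 - s)) \<le> K2 * s powr (\<mu> / 2 + 1)"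
  proof (rule right.decay_if_moderate)
    show "norm (- b (1 - s)) \<le> (K * 2 powr (\<mu> / 2)) * s powr (- \<mu> / 2)"
      if "s \<in> {0<..1/2}" for s
    proof -
      have "norm (- b (1 - s)) \<le> K * (s * (1 - s)) powr (- \<mu> / 2)"
        using b[OF half(2)[OF that]] by (simp add: mult.commute)
      then show ?thesis
        using b'[OF that] by (rule order_trans)
    qed
  qed (rule that)
  define A where "A = max 0 (max K1 K2) * 2 powr (\<mu> / 2 + 1)"
  have a: "norm (a z) \<le> A * (z * (1 - z)) powr (\<mu> / 2 + 1)" if "z \<in> {0<..<1}" for z
  proof -
    define s where "s = min z (1 - z)"
    have s: "s \<in> {0<..1/2}" "s = z \<or> s = 1 - z" "s * (1 - s) = z * (1 - z)"
      using that by (auto simp: s_def min_def)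
    have "norm (a z) \<le> max 0 (max K1 K2) * s powr (\<mu> / 2 + 1)"
    proof -
      have "norm (a z) \<le> K1 * s powr (\<mu> / 2 + 1) \<or> norm (a z) \<le> K2 * s powr (\<mu> / 2 + 1)"
        using K1[OF s(1)] K2[OF s(1)] s(2) by auto
      moreover have "K1 * s powr (\<mu> / 2 + 1) \<le> max 0 (max K1 K2) * s powr (\<mu> / 2 + 1)"
        "K2 * s powr (\<mu> / 2 + 1) \<le> max 0 (max K1 K2) * s powr (\<mu> / 2 + 1)"
        by (auto intro!: mult_right_mono)
      ultimately show ?thesis by linarith
    qed
    also have "\<dots> \<le> max 0 (max K1 K2) * (2 powr (\<mu> / 2 + 1) * (s * (1 - s)) powr (\<mu> / 2 + 1))"
      using \<mu>_nonneg by (intro mult_left_mono powr_le_symmetric s) auto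
    finally show ?thesis by (simp add: s(3) A_def mult.assoc)
  qed
  define E where "E = exp (4 * \<bar>u2\<bar>)"
  have "energy_density a b z \<le> A\<^sup>2 * E + K\<^sup>2 * E" if z: "z \<in> {0<..<1}" for z
  proof -
    define r where "r = z * (1 - z)"
    have r: "0 < r" using z by (simp add: r_def)
    have q: "r powr (\<mu> + 1) / E \<le> q z" "q z \<le> E * r powr (\<mu> + 1)"
      using q_bounds[OF z] by (auto simp: r_def E_def exp_minus field_simps)
    have "(norm (a z))\<^sup>2 \<le> (A * r powr (\<mu> / 2 + 1))\<^sup>2"
      using a[OF z] by (intro power_mono) (auto simp: r_def)
    also have "\<dots> = A\<^sup>2 * (r * r powr (\<mu> + 1))"
      using r by (simp add: power2_eq_square powr_add algebra_simps)
        (simp flip: powr_add)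
    finally have "(norm (a z))\<^sup>2 / (q z * (1 - z)) \<le> A\<^sup>2 * (r * r powr (\<mu> + 1)) / (r powr (\<mu> + 1) / E * (1 - z))"
      using q(1) r z by (intro frac_le mult_right_mono) (auto simp: E_def)
    also have "\<dots> = A\<^sup>2 * E * (r / (1 - z))"
      using r by simp
    also have "r / (1 - z) = z"
      using z by (simp add: r_def)
    also have "A\<^sup>2 * E * z \<le> A\<^sup>2 * E * 1"
      using z by (intro mult_left_mono) (auto simp: E_def)
    finally have 1: "(norm (a z))\<^sup>2 / (q z * (1 - z)) \<le> A\<^sup>2 * E" by simp
    have "(norm (b z))\<^sup>2 \<le> (K * r powr (- \<mu> / 2))\<^sup>2"
      using b[OF z] by (intro power_mono) (auto simp: r_def)
    also have "\<dots> = K\<^sup>2 * r powr (- \<mu>)"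
      by (simp add: power_mult_distrib power2_eq_square flip: powr_add)
    finally have "q z * (norm (b z))\<^sup>2 \<le> (E * r powr (\<mu> + 1)) * (K\<^sup>2 * r powr (- \<mu>))"
      using q(2) by (intro mult_mono) (auto simp: E_def)
    also have "\<dots> = K\<^sup>2 * E * (r powr (\<mu> + 1) * r powr (- \<mu>))" by simp
    also have "r powr (\<mu> + 1) * r powr (- \<mu>) = r"
      using r by (simp flip: powr_add)
    finally have "q z * (norm (b z))\<^sup>2 / z \<le> K\<^sup>2 * E * (1 - z)"
      using z by (simp add: r_def field_simps)
    also have "\<dots> \<le> K\<^sup>2 * E * 1"
      using z by (intro mult_left_mono) (auto simp: E_def)
    finally show ?thesis
      using 1 by (simp add: energy_density_def)
  qed
  with that show thesis by blast
qed

section \<open>From the canonical system to the spheroidal equation\<close>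

text \<open>
  The factor in \<open>b = mw\<close>: from \<open>w = y\<^sub>2/sqrt(z(1-z))\<close> and \<open>y\<^sub>2 = pb\<close> it is \<open>sqrt(z(1-z))/p\<close>.
\<close>

definition m :: "real \<Rightarrow> real" where
  "m z = (z * (1 - z)) powr (- \<mu> / 2) * exp (2 * u2 * z)"

text \<open>
  This is \<open>z(1-z) m'/m\<close>.
\<close>

definition k :: "real \<Rightarrow> real" where
  "k z = - \<mu> / 2 * (1 - 2 * z) + 2 * u2 * (z * (1 - z))"

lemma m_pos: "z \<in> {0<..<1} \<Longrightarrow> 0 < m z"
  by (simp add: m_def)

lemma q_times_m_square:
  assumes "z \<in> {0<..<1}"
  shows "q z * (m z)\<^sup>2 = z * (1 - z)"
proof -
  define r where "r = z * (1 - z)"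
  have "q z * (m z)\<^sup>2 = (r powr (\<mu> + 1) * (r powr (- \<mu> / 2) * r powr (- \<mu> / 2)))
      * (exp (- 4 * u2 * z) * (exp (2 * u2 * z) * exp (2 * u2 * z)))"
    by (simp add: q_def m_def r_def power2_eq_square)
  also have "\<dots> = r powr 1 * exp 0"
    unfolding powr_add[symmetric] exp_add[symmetric] by simp
  also have "\<dots> = r"
    using assms by (simp add: r_def)
  finally show ?thesis by (simp add: r_def)
qed

lemma m_deriv:
  assumes "z \<in> {0<..<1}"
  shows "(m has_real_derivative m z * k z / (z * (1 - z))) (at z)"
proof -
  have "((\<lambda>z. z * (1 - z)) has_real_derivative 1 - 2 * z) (at z)"
    by (auto intro!: derivative_eq_intros)
  then have "((\<lambda>z. (z * (1 - z)) powr (- \<mu> / 2)) has_real_derivative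
      (- \<mu> / 2) * (z * (1 - z)) powr (- \<mu> / 2 - 1) * (1 - 2 * z)) (at z)"
    using assms by (intro DERIV_chain2[OF has_real_derivative_powr]) auto
  moreover have "((\<lambda>z. exp (2 * u2 * z)) has_real_derivative 2 * u2 * exp (2 * u2 * z)) (at z)"
    by (auto intro!: derivative_eq_intros)
  ultimately have "(m has_real_derivative
      (- \<mu> / 2) * (z * (1 - z)) powr (- \<mu> / 2 - 1) * (1 - 2 * z) * exp (2 * u2 * z) +
      2 * u2 * exp (2 * u2 * z) * (z * (1 - z)) powr (- \<mu> / 2)) (at z)"
    unfolding m_def by (rule DERIV_mult)
  moreover have "(z * (1 - z)) powr (- \<mu> / 2 - 1) = (z * (1 - z)) powr (- \<mu> / 2) / (z * (1 - z))"
    using assms by (simp add: powr_diff)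
  ultimately have "(m has_real_derivative
      (- \<mu> / 2) * ((z * (1 - z)) powr (- \<mu> / 2) / (z * (1 - z))) * (1 - 2 * z) * exp (2 * u2 * z) +
      2 * u2 * exp (2 * u2 * z) * (z * (1 - z)) powr (- \<mu> / 2)) (at z)"
    by (simp only:)
  moreover have eq: "- \<mu> / 2 * (P / r) * t * e + 2 * u2 * e * P = P * e * (- \<mu> / 2 * t + 2 * u2 * r) / r"
    if "r \<noteq> 0" for r P e t :: real
    using that by (simp add: field_simps)
  moreover have nz: "z * (1 - z) \<noteq> 0"
    using assms by simp
  ultimately show ?thesis
    unfolding m_def k_def by (simp only: eq[OF nz])
qed

lemma k_deriv: "(k has_real_derivative \<mu> + 2 * u2 * (1 - 2 * z)) (at z)"
  unfolding k_def by (auto intro!: derivative_eq_intros simp: algebra_simps)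

text \<open>
  The coefficient of \<open>w\<close> in the spheroidal equation at \<open>x = 2z - 1\<close>.
\<close>

definition Q :: "real \<Rightarrow> real" where
  "Q z = u3 + \<mu> * (\<mu> + 1) + (- u3 - 2 * (\<mu> + 1) * u2) * (2 * z - 1)
    + u1 * (1 - (2 * z - 1)\<^sup>2) - \<mu>\<^sup>2 / (1 - (2 * z - 1)\<^sup>2)"

text \<open>
  The condition on \<open>Q\<close> under which \<open>b = mv\<close> solves the canonical system. All of the parameter
  correspondence between the two eigenvalue problems is in this identity.
\<close>

lemma potential_identity:
  assumes "z \<in> {0<..<1}"
  shows "Q z = 2 * g z * (z * (1 - z)) + (\<mu> + 2 * u2 * (1 - 2 * z)) - (k z)\<^sup>2 / (z * (1 - z))"
proof -
  have r: "1 - (2 * z - 1)\<^sup>2 = 4 * (z * (1 - z))"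
    by (simp add: power2_eq_square algebra_simps)
  have g: "g z * (z * (1 - z)) = u3 * (1 - z) + 2 * (u1 + u2\<^sup>2) * (z * (1 - z))"
    using assms by (simp add: g_def field_simps)
  have "(k z)\<^sup>2 = \<mu>\<^sup>2 / 4 + (z * (1 - z)) *
      (- \<mu>\<^sup>2 - 2 * u2 * \<mu> * (1 - 2 * z) + 4 * u2\<^sup>2 * (z * (1 - z)))"
    by (simp add: k_def power2_eq_square field_simps)
  then have "(k z)\<^sup>2 / (z * (1 - z)) = \<mu>\<^sup>2 / (4 * (z * (1 - z)))
      + (- \<mu>\<^sup>2 - 2 * u2 * \<mu> * (1 - 2 * z) + 4 * u2\<^sup>2 * (z * (1 - z)))"
    using assms by (simp add: add_divide_distrib)
  then show ?thesis
    unfolding Q_def r using g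
    by (simp add: power2_eq_square algebra_simps)
qed

text \<open>
  Here \<open>v(z) = w(x)\<close> and \<open>D(z) = (1-x\<^sup>2)w'(x)\<close> with \<open>x = 2z - 1\<close>. The factors \<open>2\<close> come from
  \<open>dx = 2 dz\<close> and \<open>1-x\<^sup>2 = 4z(1-z)\<close>.
\<close>

definition spheroidal_system :: "(real \<Rightarrow> complex) \<Rightarrow> (real \<Rightarrow> complex) \<Rightarrow> bool" where
  "spheroidal_system v D \<longleftrightarrow>
     (\<forall>z\<in>{0<..<1}. (v has_vector_derivative (1 / (2 * (z * (1 - z)))) *\<^sub>R D z) (at z) \<and>
                   (D has_vector_derivative (- 2 * Q z) *\<^sub>R v z) (at z))"

text \<open>
  The formula for \<open>D\<close> is \<open>2z(1-z)v'\<close> computed from \<open>v = b/m\<close> and \<open>b' = -2a/q\<close>, where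
  \<open>qm\<^sup>2 = z(1-z)\<close>. In \<open>D'\<close> the terms with \<open>a\<close> cancel.
\<close>

lemma canonical_imp_spheroidal:
  assumes sys: "canonical_system a b"
  shows "spheroidal_system (\<lambda>z. (1 / m z) *\<^sub>R b z)
    (\<lambda>z. (- 4 * m z) *\<^sub>R a z - (2 * k z / m z) *\<^sub>R b z)"
  unfolding spheroidal_system_def
proof (intro ballI conjI)
  fix z :: real assume z: "z \<in> {0<..<1}"
  define r where "r = z * (1 - z)"
  have nz: "m z \<noteq> 0" "q z \<noteq> 0" "r \<noteq> 0"
    using m_pos[OF z] q_pos[OF z] z by (auto simp: r_def)
  have qm: "q z * (m z * m z) = r"
    using q_times_m_square[OF z] by (simp add: r_def power2_eq_square)
  note m' = m_deriv[OF z, folded r_def]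
  note a' = canonical_systemD(1)[OF sys z] and b' = canonical_systemD(2)[OF sys z]
  have im': "((\<lambda>z. 1 / m z) has_real_derivative - (k z / (r * m z))) (at z)"
    using DERIV_inverse_fun[OF m' nz(1)] nz by (simp add: field_simps power2_eq_square inverse_eq_divide)
  have "((\<lambda>z. (1 / m z) *\<^sub>R b z) has_vector_derivative
      (1 / m z) *\<^sub>R (- 2 / q z) *\<^sub>R a z + - (k z / (r * m z)) *\<^sub>R b z) (at z)"
    by (intro has_vector_derivative_scaleR im' b')
  moreover have mq: "2 / (m z * q z) = 2 * m z / r"
    using nz qm by (simp add: field_simps)
  ultimately show "((\<lambda>z. (1 / m z) *\<^sub>R b z) has_vector_derivative
      (1 / (2 * (z * (1 - z)))) *\<^sub>R ((- 4 * m z) *\<^sub>R a z - (2 * k z / m z) *\<^sub>R b z)) (at z)"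
    unfolding r_def[symmetric] using nz by (simp add: algebra_simps minus_diff_commute)
  have "((\<lambda>z. - 4 * m z) has_real_derivative - 4 * (m z * k z / r)) (at z)"
    by (intro DERIV_cmult m')
  then have 1: "((\<lambda>z. (- 4 * m z) *\<^sub>R a z) has_vector_derivative
      (- 4 * m z) *\<^sub>R (g z * q z) *\<^sub>R b z + (- 4 * (m z * k z / r)) *\<^sub>R a z) (at z)"
    by (intro has_vector_derivative_scaleR a')
  have "((\<lambda>z. 2 * k z * (1 / m z)) has_real_derivative
      2 * (\<mu> + 2 * u2 * (1 - 2 * z)) * (1 / m z) + - (k z / (r * m z)) * (2 * k z)) (at z)"
    by (intro DERIV_mult DERIV_cmult k_deriv im')
  then have "((\<lambda>z. (2 * k z * (1 / m z)) *\<^sub>R b z) has_vector_derivative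
      (2 * k z * (1 / m z)) *\<^sub>R (- 2 / q z) *\<^sub>R a z
      + (2 * (\<mu> + 2 * u2 * (1 - 2 * z)) * (1 / m z) + - (k z / (r * m z)) * (2 * k z)) *\<^sub>R b z) (at z)"
    by (intro has_vector_derivative_scaleR b')
  from has_vector_derivative_diff[OF 1 this]
  have "((\<lambda>z. (- 4 * m z) *\<^sub>R a z - (2 * k z / m z) *\<^sub>R b z) has_vector_derivative
      (- 4 * (m z * k z / r) + 2 * k z * (2 / (m z * q z))) *\<^sub>R a z
      + (- 4 * (m z * g z * q z) - (2 * (\<mu> + 2 * u2 * (1 - 2 * z)) - 2 * (k z)\<^sup>2 / r) / m z) *\<^sub>R b z) (at z)"
    by (rule back_subst) (simp add: algebra_simps power2_eq_square diff_divide_distrib add_divide_distrib)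
  moreover have "- 4 * (m z * k z / r) + 2 * k z * (2 / (m z * q z)) = 0"
    unfolding mq by simp
  moreover have "- 4 * (m z * g z * q z) - (2 * (\<mu> + 2 * u2 * (1 - 2 * z)) - 2 * (k z)\<^sup>2 / r) / m z
      = - 2 * Q z / m z"
  proof -
    have "m z * q z = r / m z"
      using nz qm by (simp add: field_simps)
    then have "m z * g z * q z = g z * (r / m z)"
      by (metis mult.assoc mult.commute)
    then show ?thesis
      unfolding potential_identity[OF z, folded r_def]
      by (simp add: algebra_simps diff_divide_distrib add_divide_distrib)
  qed
  ultimately show "((\<lambda>z. (- 4 * m z) *\<^sub>R a z - (2 * k z / m z) *\<^sub>R b z) has_vector_derivative
      (- 2 * Q z) *\<^sub>R (1 / m z) *\<^sub>R b z) (at z)"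
    by simp
qed

text \<open>
  The substitution of the previous lemma solved for \<open>a\<close> and \<open>b\<close>.
\<close>

lemma spheroidal_imp_canonical:
  assumes sys: "spheroidal_system v D"
  shows "canonical_system (\<lambda>z. (- 1 / (4 * m z)) *\<^sub>R (D z + (2 * k z) *\<^sub>R v z)) (\<lambda>z. m z *\<^sub>R v z)"
  unfolding canonical_system_def
proof (intro ballI conjI)
  fix z :: real assume z: "z \<in> {0<..<1}"
  define r where "r = z * (1 - z)"
  have nz: "m z \<noteq> 0" "q z \<noteq> 0" "r \<noteq> 0"
    using m_pos[OF z] q_pos[OF z] z by (auto simp: r_def)
  have qm: "q z * (m z * m z) = r"
    using q_times_m_square[OF z] by (simp add: r_def power2_eq_square)
  note m' = m_deriv[OF z, folded r_def]
  have v': "(v has_vector_derivative (1 / (2 * r)) *\<^sub>R D z) (at z)"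
    and D': "(D has_vector_derivative (- 2 * Q z) *\<^sub>R v z) (at z)"
    using sys z unfolding spheroidal_system_def r_def by auto
  have im': "((\<lambda>z. - 1 / (4 * m z)) has_real_derivative k z / (4 * r * m z)) (at z)"
    using DERIV_cmult[OF DERIV_inverse_fun[OF m' nz(1)], of "- 1 / 4"] nz
    by (simp add: field_simps power2_eq_square inverse_eq_divide)
  have "((\<lambda>z. m z *\<^sub>R v z) has_vector_derivative
      m z *\<^sub>R (1 / (2 * r)) *\<^sub>R D z + (m z * k z / r) *\<^sub>R v z) (at z)"
    by (intro has_vector_derivative_scaleR m' v')
  moreover have "(- 2 / q z) * (- 1 / (4 * m z)) = m z / (2 * r)"
    using nz qm by (simp add: field_simps)
  then have "(- 2 / q z) *\<^sub>R (- 1 / (4 * m z)) *\<^sub>R (D z + (2 * k z) *\<^sub>R v z)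
      = (m z / (2 * r)) *\<^sub>R (D z + (2 * k z) *\<^sub>R v z)"
    by (simp only: scaleR_scaleR)
  ultimately show "((\<lambda>z. m z *\<^sub>R v z) has_vector_derivative
      (- 2 / q z) *\<^sub>R (- 1 / (4 * m z)) *\<^sub>R (D z + (2 * k z) *\<^sub>R v z)) (at z)"
    by (simp add: algebra_simps)
  have "((\<lambda>z. 2 * k z) has_real_derivative 2 * (\<mu> + 2 * u2 * (1 - 2 * z))) (at z)"
    by (intro DERIV_cmult k_deriv)
  then have "((\<lambda>z. (- 1 / (4 * m z)) *\<^sub>R (D z + (2 * k z) *\<^sub>R v z)) has_vector_derivative
      (- 1 / (4 * m z)) *\<^sub>R ((- 2 * Q z) *\<^sub>R v z +
        ((2 * k z) *\<^sub>R (1 / (2 * r)) *\<^sub>R D z + (2 * (\<mu> + 2 * u2 * (1 - 2 * z))) *\<^sub>R v z))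
      + (k z / (4 * r * m z)) *\<^sub>R (D z + (2 * k z) *\<^sub>R v z)) (at z)"
    by (intro has_vector_derivative_scaleR has_vector_derivative_add im' D' v')
  moreover have "(- 1 / (4 * m z)) *\<^sub>R ((- 2 * Q z) *\<^sub>R v z +
        ((2 * k z) *\<^sub>R (1 / (2 * r)) *\<^sub>R D z + (2 * (\<mu> + 2 * u2 * (1 - 2 * z))) *\<^sub>R v z))
      + (k z / (4 * r * m z)) *\<^sub>R (D z + (2 * k z) *\<^sub>R v z)
      = ((Q z - (\<mu> + 2 * u2 * (1 - 2 * z)) + (k z)\<^sup>2 / r) / (2 * m z)) *\<^sub>R v z"
    using nz by (simp add: algebra_simps power2_eq_square diff_divide_distrib add_divide_distrib)
  moreover have "(Q z - (\<mu> + 2 * u2 * (1 - 2 * z)) + (k z)\<^sup>2 / r) / (2 * m z) = g z * q z * m z"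
  proof -
    have "m z * q z = r / m z"
      using nz qm by (simp add: field_simps)
    then have "g z * q z * m z = g z * (r / m z)"
      by (metis mult.assoc mult.commute)
    then show ?thesis
      unfolding potential_identity[OF z, folded r_def] by simp
  qed
  ultimately show "((\<lambda>z. (- 1 / (4 * m z)) *\<^sub>R (D z + (2 * k z) *\<^sub>R v z)) has_vector_derivative
      (g z * q z) *\<^sub>R m z *\<^sub>R v z) (at z)"
    by simp
qed

lemma m_bounds:
  assumes z: "z \<in> {0<..<1}"
  shows "m z \<le> exp (2 * \<bar>u2\<bar>) * (z * (1 - z)) powr (- \<mu> / 2)"
    and "(z * (1 - z)) powr (- \<mu> / 2) \<le> exp (2 * \<bar>u2\<bar>) * m z"
proof -
  define P where "P = (z * (1 - z)) powr (- \<mu> / 2)"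
  have "0 \<le> P" by (simp add: P_def)
  have "\<bar>u2 * z\<bar> \<le> \<bar>u2\<bar>"
    using z mult_left_le[of z "\<bar>u2\<bar>"] by (simp add: abs_mult)
  then have e: "2 * u2 * z \<le> 2 * \<bar>u2\<bar>" "0 \<le> 2 * \<bar>u2\<bar> + 2 * u2 * z"
    by (auto simp: abs_le_iff)
  show "m z \<le> exp (2 * \<bar>u2\<bar>) * (z * (1 - z)) powr (- \<mu> / 2)"
    using mult_left_mono[of "exp (2 * u2 * z)" "exp (2 * \<bar>u2\<bar>)" P] e(1) \<open>0 \<le> P\<close>
    by (simp add: m_def P_def mult.commute)
  have "P * 1 \<le> P * exp (2 * \<bar>u2\<bar> + 2 * u2 * z)"
    using e(2) \<open>0 \<le> P\<close> by (intro mult_left_mono) auto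
  then show "(z * (1 - z)) powr (- \<mu> / 2) \<le> exp (2 * \<bar>u2\<bar>) * m z"
    by (simp add: m_def P_def exp_add mult_ac)
qed

abbreviation \<beta> :: real where "\<beta> \<equiv> - u3 - 2 * (\<mu> + 1) * u2"
abbreviation ev :: complex where "ev \<equiv> complex_of_real (u3 + \<mu> * (\<mu> + 1))"

lemma solution_imp_spheroidal:
  assumes w: "coulomb_spheroidal_solution \<mu> \<beta> u1 ev w"
  shows "spheroidal_system (\<lambda>z. w (2 * z - 1))
    (\<lambda>z. of_real (1 - (2 * z - 1)\<^sup>2) * vector_derivative w (at (2 * z - 1)))"
  unfolding spheroidal_system_def
proof (intro ballI conjI)
  fix z :: real assume z: "z \<in> {0<..<1}"
  define x where "x = 2 * z + (- 1)"
  define P where "P t = of_real (1 - t\<^sup>2) * vector_derivative w (at t)" for t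
  have x: "x \<in> {-1<..<1}" using z by (auto simp: x_def)
  have w': "(w has_vector_derivative vector_derivative w (at x)) (at x)"
    and P': "(P has_vector_derivative vector_derivative P (at x)) (at x)"
    and eq: "vector_derivative P (at x) +
      (ev + of_real (\<beta> * x + u1 * (1 - x\<^sup>2) - \<mu>\<^sup>2 / (1 - x\<^sup>2))) * w x = 0"
    using w x unfolding coulomb_spheroidal_solution_def P_def vector_derivative_works[symmetric]
    by auto
  have r: "1 - x\<^sup>2 = 4 * (z * (1 - z))"
    by (simp add: x_def power2_eq_square algebra_simps)
  have "((\<lambda>z. w (2 * z + (- 1))) has_vector_derivative 2 *\<^sub>R vector_derivative w (at x)) (at z)"
    using w' unfolding x_def by (rule has_vector_derivative_affine)
  moreover have "(1 / (2 * (z * (1 - z)))) *\<^sub>R P x = 2 *\<^sub>R vector_derivative w (at x)"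
  proof -
    have "1 / (2 * s) * (4 * s) = 2" if "s \<noteq> 0" for s :: real
      using that by simp
    from this[of "z * (1 - z)"] show ?thesis
      unfolding P_def r scaleR_conv_of_real[symmetric] scaleR_scaleR using z by simp
  qed
  ultimately show "((\<lambda>z. w (2 * z - 1)) has_vector_derivative (1 / (2 * (z * (1 - z)))) *\<^sub>R
      (of_real (1 - (2 * z - 1)\<^sup>2) * vector_derivative w (at (2 * z - 1)))) (at z)"
    by (simp add: x_def P_def)
  have Q: "ev + of_real (\<beta> * x + u1 * (1 - x\<^sup>2) - \<mu>\<^sup>2 / (1 - x\<^sup>2)) = of_real (Q z)"
    by (simp add: Q_def x_def)
  have "vector_derivative P (at x) = - (Q z *\<^sub>R w x)"
    using eq unfolding Q by (simp add: scaleR_conv_of_real eq_neg_iff_add_eq_0)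
  moreover have "((\<lambda>z. P (2 * z + (- 1))) has_vector_derivative 2 *\<^sub>R vector_derivative P (at x)) (at z)"
    using P' unfolding x_def by (rule has_vector_derivative_affine)
  ultimately show "((\<lambda>z. of_real (1 - (2 * z - 1)\<^sup>2) * vector_derivative w (at (2 * z - 1)))
      has_vector_derivative (- 2 * Q z) *\<^sub>R w (2 * z - 1)) (at z)"
    by (simp add: x_def P_def)
qed

lemma spheroidal_imp_solution:
  assumes sys: "spheroidal_system v D"
  shows "coulomb_spheroidal_solution \<mu> \<beta> u1 ev (\<lambda>x. v (1 / 2 * x + 1 / 2))"
proof -
  define w where "w x = v (1 / 2 * x + 1 / 2)" for x
  define P where "P t = of_real (1 - t\<^sup>2) * vector_derivative w (at t)" for t
  have z: "1 / 2 * x + 1 / 2 \<in> {0<..<1}" if "x \<in> {-1<..<1}" for x :: real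
    using that by auto
  have w': "(w has_vector_derivative (1 / (1 - x\<^sup>2)) *\<^sub>R D (1 / 2 * x + 1 / 2)) (at x)"
    if x: "x \<in> {-1<..<1}" for x
  proof -
    define z' where "z' = 1 / 2 * x + 1 / 2"
    have "(v has_vector_derivative (1 / (2 * (z' * (1 - z')))) *\<^sub>R D z') (at z')"
      using sys z[OF x] unfolding spheroidal_system_def z'_def by blast
    then have "(w has_vector_derivative (1 / 2) *\<^sub>R (1 / (2 * (z' * (1 - z')))) *\<^sub>R D z') (at x)"
      unfolding w_def z'_def by (rule has_vector_derivative_affine)
    moreover have "1 - x\<^sup>2 = 4 * (z' * (1 - z'))"
      by (simp add: z'_def power2_eq_square field_simps)
    ultimately show ?thesis
      unfolding z'_def[symmetric] by simp
  qed
  have P_eq: "P x = D (1 / 2 * x + 1 / 2)" if x: "x \<in> {-1<..<1}" for x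
  proof -
    have "1 - x\<^sup>2 \<noteq> 0"
      using x abs_square_less_1[of x] by auto
    then have "complex_of_real (1 - x\<^sup>2) \<noteq> 0"
      by (simp only: of_real_eq_0_iff not_False_eq_True)
    then show ?thesis
      unfolding P_def vector_derivative_at[OF w'[OF x]] scaleR_conv_of_real of_real_divide by simp
  qed
  have P': "(P has_vector_derivative - (Q (1 / 2 * x + 1 / 2) *\<^sub>R w x)) (at x)" if x: "x \<in> {-1<..<1}" for x
  proof -
    define z' where "z' = 1 / 2 * x + 1 / 2"
    have "(D has_vector_derivative (- 2 * Q z') *\<^sub>R v z') (at z')"
      using sys z[OF x] unfolding spheroidal_system_def z'_def by blast
    then have "((\<lambda>x. D (1 / 2 * x + 1 / 2)) has_vector_derivative (1 / 2) *\<^sub>R (- 2 * Q z') *\<^sub>R v z') (at x)"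
      unfolding z'_def by (rule has_vector_derivative_affine)
    then have "((\<lambda>x. D (1 / 2 * x + 1 / 2)) has_vector_derivative - (Q z' *\<^sub>R w x)) (at x)"
      by (simp add: w_def z'_def)
    then show ?thesis
      unfolding z'_def
      by (rule has_vector_derivative_transform_within_open[of _ _ _ "{-1<..<1}"]) (use x P_eq in auto)
  qed
  have "coulomb_spheroidal_solution \<mu> \<beta> u1 ev w"
    unfolding coulomb_spheroidal_solution_def P_def[symmetric]
  proof (intro ballI conjI)
    fix x :: real assume x: "x \<in> {-1<..<1}"
    show "w differentiable at x" using w'[OF x] by (rule differentiableI_vector)
    show "P differentiable at x" using P'[OF x] by (rule differentiableI_vector)
    have "ev + of_real (\<beta> * x + u1 * (1 - x\<^sup>2) - \<mu>\<^sup>2 / (1 - x\<^sup>2)) = of_real (Q (1 / 2 * x + 1 / 2))"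
      by (simp add: Q_def)
    then show "vector_derivative P (at x) +
        (ev + of_real (\<beta> * x + u1 * (1 - x\<^sup>2) - \<mu>\<^sup>2 / (1 - x\<^sup>2))) * w x = 0"
      unfolding vector_derivative_at[OF P'[OF x]] by (simp add: scaleR_conv_of_real)
  qed
  then show ?thesis by (simp only: w_def[abs_def])
qed

lemma coulomb_spheroidal_eigenvalue_iff_moderate:
  "coulomb_spheroidal_eigenvalue \<mu> \<beta> u1 ev \<longleftrightarrow>
    (\<exists>a b K. canonical_system a b \<and> (\<exists>z\<in>{0<..<1}. b z \<noteq> 0) \<and>
      (\<forall>z\<in>{0<..<1}. norm (b z) \<le> K * (z * (1 - z)) powr (- \<mu> / 2)))"
proof
  assume "coulomb_spheroidal_eigenvalue \<mu> \<beta> u1 ev"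
  then obtain w x0 where w: "coulomb_spheroidal_solution \<mu> \<beta> u1 ev w"
    and x0: "x0 \<in> {-1<..<1}" "w x0 \<noteq> 0" and bdd: "bounded (w ` {-1<..<1})"
    unfolding coulomb_spheroidal_eigenvalue_def by auto
  obtain B where B: "0 < B" "\<And>x. x \<in> {-1<..<1} \<Longrightarrow> norm (w x) \<le> B"
    using bdd unfolding bounded_pos by auto
  define b where "b z = m z *\<^sub>R w (2 * z - 1)" for z
  obtain a where sys: "canonical_system a b"
    using spheroidal_imp_canonical[OF solution_imp_spheroidal[OF w]] unfolding b_def[abs_def] by blast
  have "b ((x0 + 1) / 2) \<noteq> 0" "(x0 + 1) / 2 \<in> {0<..<1}"
    using x0 m_pos[of "(x0 + 1) / 2"] by (auto simp: b_def field_simps)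
  moreover have "norm (b z) \<le> (exp (2 * \<bar>u2\<bar>) * B) * (z * (1 - z)) powr (- \<mu> / 2)"
    if z: "z \<in> {0<..<1}" for z
  proof -
    have "norm (b z) = m z * norm (w (2 * z - 1))"
      using m_pos[OF z] by (simp add: b_def)
    also have "\<dots> \<le> (exp (2 * \<bar>u2\<bar>) * (z * (1 - z)) powr (- \<mu> / 2)) * B"
      using m_pos[OF z] m_bounds(1)[OF z] B(2)[of "2 * z - 1"] z by (intro mult_mono) auto
    finally show ?thesis by (simp add: mult_ac)
  qed
  ultimately show "\<exists>a b K. canonical_system a b \<and> (\<exists>z\<in>{0<..<1}. b z \<noteq> 0) \<and>
      (\<forall>z\<in>{0<..<1}. norm (b z) \<le> K * (z * (1 - z)) powr (- \<mu> / 2))"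
    using sys by blast
next
  assume "\<exists>a b K. canonical_system a b \<and> (\<exists>z\<in>{0<..<1}. b z \<noteq> 0) \<and>
      (\<forall>z\<in>{0<..<1}. norm (b z) \<le> K * (z * (1 - z)) powr (- \<mu> / 2))"
  then obtain a b K z0 where sys: "canonical_system a b" and z0: "z0 \<in> {0<..<1}" "b z0 \<noteq> 0"
    and K: "\<And>z. z \<in> {0<..<1} \<Longrightarrow> norm (b z) \<le> K * (z * (1 - z)) powr (- \<mu> / 2)"
    by blast
  define v where "v z = (1 / m z) *\<^sub>R b z" for z
  define w where "w x = v (1 / 2 * x + 1 / 2)" for x
  have "coulomb_spheroidal_solution \<mu> \<beta> u1 ev w"
    using spheroidal_imp_solution[OF canonical_imp_spheroidal[OF sys]]
    unfolding w_def[abs_def] v_def .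
  moreover have "w (2 * z0 - 1) \<noteq> 0" "2 * z0 - 1 \<in> {-1<..<1}"
    using z0 m_pos[OF z0(1)] by (auto simp: w_def v_def algebra_simps)
  moreover have "bounded (w ` {-1<..<1})"
  proof (rule boundedI)
    fix y assume "y \<in> w ` {-1<..<1}"
    then obtain x where x: "x \<in> {-1<..<1}" "y = w x" by blast
    define z where "z = 1 / 2 * x + 1 / 2"
    have z: "z \<in> {0<..<1}" using x by (auto simp: z_def)
    have "0 < (z * (1 - z)) powr (- \<mu> / 2)" using z by simp
    moreover have "0 \<le> K * (z * (1 - z)) powr (- \<mu> / 2)"
      using order_trans[OF norm_ge_zero K[OF z]] .
    ultimately have "0 \<le> K" by (simp add: zero_le_mult_iff)
    have "norm (b z) \<le> K * (exp (2 * \<bar>u2\<bar>) * m z)"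
      using K[OF z] mult_left_mono[OF m_bounds(2)[OF z] \<open>0 \<le> K\<close>] by (rule order_trans)
    moreover have "norm y = norm (b z) / m z"
      using m_pos[OF z] unfolding x(2) w_def v_def z_def[symmetric] by simp
    ultimately show "norm y \<le> K * exp (2 * \<bar>u2\<bar>)"
      using m_pos[OF z] by (simp add: divide_le_eq mult_ac)
  qed
  ultimately show "coulomb_spheroidal_eigenvalue \<mu> \<beta> u1 ev"
    unfolding coulomb_spheroidal_eigenvalue_def by blast
qed

end

section \<open>From the canonical system to the operator\<close>

lemma not_AE_zero_if_continuous:
  fixes f :: "'a::euclidean_space \<Rightarrow> 'b::real_normed_vector"
  assumes cont: "continuous_on S f" and "open S" and x: "x \<in> S" "f x \<noteq> 0"
  shows "\<not> (AE z in lebesgue_on S. f z = 0)"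
proof
  assume "AE z in lebesgue_on S. f z = 0"
  then have "AE z in lebesgue. z \<in> S \<longrightarrow> f z = 0"
    using \<open>open S\<close> by (subst (asm) AE_restrict_space_iff) auto
  then obtain N where N: "N \<in> null_sets lebesgue"
      "{z \<in> space lebesgue. \<not> (z \<in> S \<longrightarrow> f z = 0)} \<subseteq> N"
    unfolding eventually_ae_filter by blast
  have "negligible (S \<inter> f -` (- {0}))"
    by (rule negligible_subset[of N]) (use N in \<open>auto simp: negligible_iff_null_sets\<close>)
  moreover have "open (S \<inter> f -` (- {0}))"
    using cont \<open>open S\<close> by (rule continuous_open_preimage) (simp add: open_Compl)
  moreover have "x \<in> S \<inter> f -` (- {0})"
    using x by simp
  ultimately show False
    using open_not_negligible by blast
qed

lemma has_vector_derivative_vecI: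
  fixes f :: "real \<Rightarrow> 'a::real_normed_vector ^ 'n"
  assumes "\<And>i. ((\<lambda>x. f x $ i) has_vector_derivative f' $ i) (at x within S)"
  shows "(f has_vector_derivative f') (at x within S)"
  unfolding has_vector_derivative_def has_derivative_within
proof (intro conjI vec_tendstoI)
  fix i
  show "((\<lambda>y. ((1 / norm (y - x)) *\<^sub>R (f y - (f x + (y - x) *\<^sub>R f'))) $ i) \<longlongrightarrow> 0 $ i) (at x within S)"
    using assms[of i] unfolding has_vector_derivative_def has_derivative_within by simp
qed (rule bounded_linear_scaleR_left)

lemma Wmat_inverse:
  assumes "z \<in> {0<..<1}"
  shows "Wmat z *v (matrix_inv (Wmat z) *v x) = x"
proof -
  define V :: "complex^2^2" where "V = vector [vector [of_real (1 - z), 0], vector [0, of_real z]]"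
  have "complex_of_real (1 - z) \<noteq> 0"
    using assms unfolding of_real_eq_0_iff by simp
  then have nz: "complex_of_real z \<noteq> 0" "1 - complex_of_real z \<noteq> 0"
    using assms by auto
  have "Wmat z ** V = mat 1" "V ** Wmat z = mat 1"
    using nz by (auto simp: Wmat_def V_def matrix_matrix_mult_def mat_def vec_eq_iff forall_2 sum_2)
  then have "\<exists>V. Wmat z ** V = mat 1 \<and> V ** Wmat z = mat 1"
    by blast
  then have "Wmat z ** matrix_inv (Wmat z) = mat 1"
    unfolding matrix_inv_def by (metis (mono_tags, lifting) someI_ex)
  then show ?thesis
    by (simp add: matrix_vector_mul_assoc)
qed

context coulomb_parameters
begin

text \<open>
  The off-diagonal entry of \<open>H\<close>.
\<close>

definition h :: "real \<Rightarrow> real" where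
  "h z = - alpha \<mu> / z + alpha \<mu> / (1 - z) + 2 * u2"

definition p :: "real \<Rightarrow> real" where
  "p z = (z * (1 - z)) powr alpha \<mu> * exp (- 2 * u2 * z)"

lemma p_pos: "z \<in> {0<..<1} \<Longrightarrow> 0 < p z"
  by (simp add: p_def)

lemma p_square: "p z * p z = q z"
proof -
  have "p z * p z = ((z * (1 - z)) powr alpha \<mu> * (z * (1 - z)) powr alpha \<mu>)
      * (exp (- 2 * u2 * z) * exp (- 2 * u2 * z))"
    by (simp add: p_def)
  also have "\<dots> = q z"
    unfolding powr_add[symmetric] exp_add[symmetric] by (simp add: q_def alpha_def)
  finally show ?thesis .
qed

text \<open>
  This equation is the reason for the choice of \<open>p\<close>: it makes the factors \<open>1/p\<close> and \<open>p\<close> cancel the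
  diagonal terms \<open>hy\<^sub>1\<close> and \<open>-hy\<^sub>2\<close> of the equations for \<open>y'\<close>.
\<close>

lemma p_deriv:
  assumes "z \<in> {0<..<1}"
  shows "(p has_real_derivative - h z * p z) (at z)"
proof -
  have "((\<lambda>z. z * (1 - z)) has_real_derivative 1 - 2 * z) (at z)"
    by (auto intro!: derivative_eq_intros)
  then have "((\<lambda>z. (z * (1 - z)) powr alpha \<mu>) has_real_derivative
      alpha \<mu> * (z * (1 - z)) powr (alpha \<mu> - 1) * (1 - 2 * z)) (at z)"
    using assms by (intro DERIV_chain2[OF has_real_derivative_powr]) auto
  moreover have "((\<lambda>z. exp (- 2 * u2 * z)) has_real_derivative - 2 * u2 * exp (- 2 * u2 * z)) (at z)"
    by (auto intro!: derivative_eq_intros)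
  ultimately have "(p has_real_derivative
      alpha \<mu> * (z * (1 - z)) powr (alpha \<mu> - 1) * (1 - 2 * z) * exp (- 2 * u2 * z) +
      - 2 * u2 * exp (- 2 * u2 * z) * (z * (1 - z)) powr alpha \<mu>) (at z)"
    unfolding p_def by (rule DERIV_mult)
  moreover have "(z * (1 - z)) powr (alpha \<mu> - 1) = (z * (1 - z)) powr alpha \<mu> / (z * (1 - z))"
    using assms by (simp add: powr_diff)
  moreover have "alpha \<mu> * (P / (z * (1 - z))) * (1 - 2 * z) * e + - 2 * u2 * e * P = - h z * (P * e)" for P e
  proof -
    have "z \<noteq> 0" "1 - z \<noteq> 0" using assms by auto
    then have "(1 - 2 * z) / (z * (1 - z)) = 1 / z - 1 / (1 - z)"
      by (simp add: diff_frac_eq)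
    then have "alpha \<mu> * (P / (z * (1 - z))) * (1 - 2 * z) * e = alpha \<mu> * P * e * (1 / z - 1 / (1 - z))"
      by (metis (no_types, opaque_lifting) mult.assoc mult.commute times_divide_eq_right)
    then show ?thesis by (simp add: h_def algebra_simps)
  qed
  ultimately show ?thesis
    unfolding p_def by (simp only:)
qed

text \<open>
  The right-hand side of \<open>Jy' = Hy\<close> solved for \<open>y'\<close>.
\<close>

definition rhs :: "real \<Rightarrow> complex^2 \<Rightarrow> complex^2" where
  "rhs z v = (\<chi> i. if i = 1 then h z *\<^sub>R v $ 1 + g z *\<^sub>R v $ 2 else (- 2) *\<^sub>R v $ 1 - h z *\<^sub>R v $ 2)"

lemma tau_eq_0_iff:
  assumes z: "z \<in> {0<..<1}" and u: "u $ 1 = u1" "u $ 2 = u2" "u $ 3 = u3"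
  shows "tau \<mu> u y z = 0 \<longleftrightarrow> vector_derivative y (at z) = rhs z (y z)"
proof -
  let ?d = "Jmat *v vector_derivative y (at z) - Hmat \<mu> u z *v y z"
  have "tau \<mu> u y z = 0 \<longleftrightarrow> ?d = 0"
    unfolding tau_def using Wmat_inverse[OF z, of ?d] by (metis matrix_vector_mult_0_right)
  also have "\<dots> \<longleftrightarrow> vector_derivative y (at z) = rhs z (y z)"
    unfolding vec_eq_iff forall_2
    by (auto simp: Jmat_def Hmat_def matrix_vector_mult_def sum_2 rhs_def h_def g_def u
        scaleR_conv_of_real algebra_simps eq_diff_eq diff_eq_eq eq_neg_iff_add_eq_0)
  finally show ?thesis .
qed

lemma continuous_on_rhs:
  assumes "continuous_on {0<..<1} y"
  shows "continuous_on {0<..<1} (\<lambda>z. rhs z (y z))"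
  unfolding rhs_def
proof (rule continuous_on_vec_lambda)
  fix i :: 2
  show "continuous_on {0<..<1} (\<lambda>z. if i = 1 then h z *\<^sub>R y z $ 1 + g z *\<^sub>R y z $ 2
      else (- 2) *\<^sub>R y z $ 1 - h z *\<^sub>R y z $ 2)"
    unfolding h_def g_def
    by (cases "i = 1") (auto intro!: continuous_intros assms)
qed

lemma canonical_if_ode:
  assumes y: "\<And>z. z \<in> {0<..<1} \<Longrightarrow> (y has_vector_derivative rhs z (y z)) (at z)"
  shows "canonical_system (\<lambda>z. p z *\<^sub>R y z $ 1) (\<lambda>z. (1 / p z) *\<^sub>R y z $ 2)"
  unfolding canonical_system_def
proof (intro ballI conjI)
  fix z :: real assume z: "z \<in> {0<..<1}"
  have p: "p z \<noteq> 0" using p_pos[OF z] by simp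
  have y1: "((\<lambda>z. y z $ 1) has_vector_derivative h z *\<^sub>R y z $ 1 + g z *\<^sub>R y z $ 2) (at z)"
    and y2: "((\<lambda>z. y z $ 2) has_vector_derivative (- 2) *\<^sub>R y z $ 1 - h z *\<^sub>R y z $ 2) (at z)"
    using bounded_linear.has_vector_derivative[OF bounded_linear_vec_nth y[OF z], of 1]
      bounded_linear.has_vector_derivative[OF bounded_linear_vec_nth y[OF z], of 2]
    by (simp_all add: rhs_def)
  have "((\<lambda>z. p z *\<^sub>R y z $ 1) has_vector_derivative
      p z *\<^sub>R (h z *\<^sub>R y z $ 1 + g z *\<^sub>R y z $ 2) + (- h z * p z) *\<^sub>R y z $ 1) (at z)"
    by (intro has_vector_derivative_scaleR p_deriv z y1)
  then show "((\<lambda>z. p z *\<^sub>R y z $ 1) has_vector_derivative (g z * q z) *\<^sub>R (1 / p z) *\<^sub>R y z $ 2) (at z)"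
    using p by (simp add: algebra_simps flip: p_square)
  have ip: "((\<lambda>z. 1 / p z) has_real_derivative h z / p z) (at z)"
    using DERIV_inverse_fun[OF p_deriv[OF z] p] p by (simp add: field_simps power2_eq_square inverse_eq_divide)
  have "((\<lambda>z. (1 / p z) *\<^sub>R y z $ 2) has_vector_derivative
      (1 / p z) *\<^sub>R ((- 2) *\<^sub>R y z $ 1 - h z *\<^sub>R y z $ 2) + (h z / p z) *\<^sub>R y z $ 2) (at z)"
    by (intro has_vector_derivative_scaleR ip y2)
  then show "((\<lambda>z. (1 / p z) *\<^sub>R y z $ 2) has_vector_derivative (- 2 / q z) *\<^sub>R p z *\<^sub>R y z $ 1) (at z)"
    using p by (simp add: algebra_simps flip: p_square)
qed

lemma ode_if_canonical:
  assumes sys: "canonical_system a b" and z: "z \<in> {0<..<1}"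
  defines "y \<equiv> \<lambda>z. vector [(1 / p z) *\<^sub>R a z, p z *\<^sub>R b z] :: complex^2"
  shows "(y has_vector_derivative rhs z (y z)) (at z)"
proof (rule has_vector_derivative_vecI)
  fix i :: 2
  have p: "p z \<noteq> 0" using p_pos[OF z] by simp
  have ip: "((\<lambda>z. 1 / p z) has_real_derivative h z / p z) (at z)"
    using DERIV_inverse_fun[OF p_deriv[OF z] p] p by (simp add: field_simps power2_eq_square inverse_eq_divide)
  have "((\<lambda>z. (1 / p z) *\<^sub>R a z) has_vector_derivative
      (1 / p z) *\<^sub>R (g z * q z) *\<^sub>R b z + (h z / p z) *\<^sub>R a z) (at z)"
    by (intro has_vector_derivative_scaleR ip canonical_systemD(1)[OF sys z])
  then have 1: "((\<lambda>z. (1 / p z) *\<^sub>R a z) has_vector_derivative rhs z (y z) $ 1) (at z)"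
    using p by (simp add: rhs_def y_def algebra_simps flip: p_square)
  have "((\<lambda>z. p z *\<^sub>R b z) has_vector_derivative
      p z *\<^sub>R (- 2 / q z) *\<^sub>R a z + (- h z * p z) *\<^sub>R b z) (at z)"
    by (intro has_vector_derivative_scaleR p_deriv z canonical_systemD(2)[OF sys z])
  then have 2: "((\<lambda>z. p z *\<^sub>R b z) has_vector_derivative rhs z (y z) $ 2) (at z)"
    using p by (simp add: rhs_def y_def algebra_simps flip: p_square)
  show "((\<lambda>z. y z $ i) has_vector_derivative rhs z (y z) $ i) (at z)"
    using 1 2 exhaust_2[of i] by (auto simp: y_def)
qed

lemma adjoint_mult_Wmat:
  assumes "z \<in> {0<..<1}"
  shows "adjoint_mult v (Wmat z *v v) = of_real ((norm (v $ 1))\<^sup>2 / (1 - z) + (norm (v $ 2))\<^sup>2 / z)"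
  unfolding adjoint_mult_def sum_2
  by (simp add: Wmat_def matrix_vector_mult_def sum_2 complex_norm_square[symmetric]
      mult.left_commute[of "cnj _"] mult.commute[of "cnj _"] del: of_real_power)

lemma energy_density_eq:
  assumes z: "z \<in> {0<..<1}"
  shows "energy_density (\<lambda>z. p z *\<^sub>R y z $ 1) (\<lambda>z. (1 / p z) *\<^sub>R y z $ 2) z
    = (norm (y z $ 1))\<^sup>2 / (1 - z) + (norm (y z $ 2))\<^sup>2 / z"
  using p_pos[OF z] unfolding energy_density_def p_square[symmetric]
  by (simp add: power_mult_distrib power_divide power2_eq_square)

lemma canonical_nontrivial_imp_b_nontrivial:
  assumes sys: "canonical_system a b" and "z0 \<in> {0<..<1}" "a z0 \<noteq> 0 \<or> b z0 \<noteq> 0"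
  shows "\<exists>z\<in>{0<..<1}. b z \<noteq> 0"
proof (rule ccontr)
  assume "\<not> ?thesis"
  then have b0: "b z = 0" if "z \<in> {0<..<1}" for z using that by blast
  have "(b has_vector_derivative 0) (at z0)"
    by (rule has_vector_derivative_transform_within_open[OF has_vector_derivative_const, of "{0<..<1}"])
      (use assms b0 in auto)
  then have "(- 2 / q z0) *\<^sub>R a z0 = 0"
    using canonical_systemD(2)[OF sys assms(2)] vector_derivative_unique_at by blast
  with q_pos[OF assms(2)] have "a z0 = 0" by auto
  with b0[OF assms(2)] assms(3) show False by simp
qed

text \<open>
  An eigenfunction solves the differential equation almost everywhere, hence everywhere by absolute
  continuity, and its components can be rescaled by \<open>p\<close>.
\<close>

lemma T_eigenvalue_imp_canonical:
  assumes u: "u $ 1 = u1" "u $ 2 = u2" "u $ 3 = u3" and ev: "T_eigenvalue \<mu> u 0"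
  obtains a b where "canonical_system a b" "\<exists>z\<in>{0<..<1}. b z \<noteq> 0"
    "energy_density a b integrable_on {0<..<1}"
proof -
  obtain y where y: "y \<in> T_domain \<mu> u" and nz: "\<not> (AE z in unit_measure. y z = 0)"
    and T: "AE z in unit_measure. T_op \<mu> u y z = 0 *s y z"
    using ev unfolding T_eigenvalue_def by blast
  have ac: "locally_abs_continuous_on {0<..<1} y"
    and diff: "AE z in unit_measure. y differentiable (at z)"
    and int: "integrable unit_measure (\<lambda>z. adjoint_mult (y z) (Wmat z *v y z))"
    using y unfolding T_domain_def L2W_def by auto
  have cont: "continuous_on {0<..<1} y"
    by (rule locally_abs_continuous_on_imp_continuous_on[OF ac]) simp
  have ae: "AE z in unit_measure. (y has_vector_derivative rhs z (y z)) (at z)"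
    using diff T AE_space
  proof eventually_elim
    case (elim z)
    then have z: "z \<in> {0<..<1}" by simp
    from elim have "tau \<mu> u y z = 0" by (simp add: T_op_def)
    with elim(1) show ?case
      using tau_eq_0_iff[OF z u] vector_derivative_works by metis
  qed
  have ode: "(y has_vector_derivative rhs z (y z)) (at z)" if "z \<in> {0<..<1}" for z
    by (rule locally_abs_continuous_on_imp_has_vector_derivative[OF ac _ ae continuous_on_rhs[OF cont] that])
      simp
  define a where "a z = p z *\<^sub>R y z $ 1" for z
  define b where "b z = (1 / p z) *\<^sub>R y z $ 2" for z
  have sys: "canonical_system a b"
    using canonical_if_ode[OF ode] unfolding a_def[abs_def] b_def[abs_def] .
  have "\<exists>z\<in>{0<..<1}. y z \<noteq> 0"
  proof (rule ccontr)
    assume "\<not> ?thesis"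
    then have "AE z in unit_measure. y z = 0"
      by (intro AE_I2) auto
    with nz show False by contradiction
  qed
  then obtain z0 where z0: "z0 \<in> {0<..<1}" "y z0 \<noteq> 0" by blast
  then have "a z0 \<noteq> 0 \<or> b z0 \<noteq> 0"
    using p_pos[OF z0(1)] by (auto simp: a_def b_def vec_eq_iff forall_2)
  then have nontriv: "\<exists>z\<in>{0<..<1}. b z \<noteq> 0"
    by (rule canonical_nontrivial_imp_b_nontrivial[OF sys z0(1)])
  have "integrable unit_measure (\<lambda>z. Re (adjoint_mult (y z) (Wmat z *v y z)))"
    using int by (rule integrable_Re)
  then have "(\<lambda>z. Re (adjoint_mult (y z) (Wmat z *v y z))) integrable_on {0<..<1}"
    by (rule integrable_on_lebesgue_on) simp
  then have "energy_density a b integrable_on {0<..<1}"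
  proof (rule integrable_eq)
    fix z :: real assume z: "z \<in> {0<..<1}"
    show "Re (adjoint_mult (y z) (Wmat z *v y z)) = energy_density a b z"
      unfolding adjoint_mult_Wmat[OF z] a_def[abs_def] b_def[abs_def] energy_density_eq[OF z] by simp
  qed
  with sys nontriv that show thesis by blast
qed

text \<open>
  The function \<open>y\<close> built from \<open>a\<close> and \<open>b\<close> is continuously differentiable with \<open>\<tau>y = 0\<close> pointwise, so
  the domain conditions reduce to the bound on the energy density.
\<close>

lemma canonical_imp_T_eigenvalue:
  assumes u: "u $ 1 = u1" "u $ 2 = u2" "u $ 3 = u3"
    and sys: "canonical_system a b" and z0: "z0 \<in> {0<..<1}" "b z0 \<noteq> 0"
    and B: "\<And>z. z \<in> {0<..<1} \<Longrightarrow> energy_density a b z \<le> B"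
  shows "T_eigenvalue \<mu> u 0"
proof -
  define y :: "real \<Rightarrow> complex^2" where "y z = vector [(1 / p z) *\<^sub>R a z, p z *\<^sub>R b z]" for z
  have ode: "(y has_vector_derivative rhs z (y z)) (at z)" if "z \<in> {0<..<1}" for z
    using ode_if_canonical[OF sys that] unfolding y_def[abs_def] .
  have cont: "continuous_on {0<..<1} y"
    by (intro continuous_at_imp_continuous_on ballI has_vector_derivative_continuous[OF ode])
  have tau0: "tau \<mu> u y z = 0" if z: "z \<in> {0<..<1}" for z
    using tau_eq_0_iff[OF z u] vector_derivative_at[OF ode[OF z]] by simp
  have energy: "adjoint_mult (y z) (Wmat z *v y z) = of_real (energy_density a b z)" if z: "z \<in> {0<..<1}" for z
  proof -
    have "energy_density a b z = energy_density (\<lambda>z. p z *\<^sub>R y z $ 1) (\<lambda>z. (1 / p z) *\<^sub>R y z $ 2) z"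
      using p_pos[OF z] by (simp add: energy_density_def y_def)
    then show ?thesis
      unfolding adjoint_mult_Wmat[OF z] energy_density_eq[OF z] by simp
  qed
  have "y \<in> L2W"
    unfolding L2W_def
  proof (intro CollectI conjI)
    show "y \<in> borel_measurable unit_measure"
      by (rule continuous_imp_measurable_on_sets_lebesgue[OF cont]) simp
    have "integrable unit_measure (\<lambda>z. complex_of_real (energy_density a b z))"
    proof (rule finite_measure.integrable_const_bound)
      show "finite_measure unit_measure"
        by (rule finite_measure_lebesgue_on) simp
      have "norm (complex_of_real (energy_density a b z)) \<le> B" if z: "z \<in> {0<..<1}" for z
        using B[OF z] energy_density_ge(2)[OF z, of b a] q_pos[OF z] z
        by (smt (verit) divide_nonneg_pos greaterThanLessThan_iff mult_nonneg_nonneg norm_of_real zero_le_power2)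
      then show "AE z in unit_measure. norm (complex_of_real (energy_density a b z)) \<le> B"
        by (intro AE_I2) auto
      show "(\<lambda>z. complex_of_real (energy_density a b z)) \<in> borel_measurable unit_measure"
        by (rule continuous_imp_measurable_on_sets_lebesgue)
          (auto intro: continuous_on_of_real continuous_on_energy_density[OF sys])
    qed
    then show "integrable unit_measure (\<lambda>z. adjoint_mult (y z) (Wmat z *v y z))"
      by (rule Bochner_Integration.integrable_cong[THEN iffD1, rotated 2]) (auto simp: energy)
  qed
  moreover have "locally_abs_continuous_on {0<..<1} y"
    using ode continuous_on_rhs[OF cont] by (rule locally_abs_continuous_on_if_continuous_derivative)
  moreover have "AE z in unit_measure. y differentiable (at z)"
    using ode by (intro AE_I2) (auto intro: differentiableI_vector)
  moreover have "tau \<mu> u y \<in> L2W"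
    unfolding L2W_def
  proof (intro CollectI conjI)
    show "tau \<mu> u y \<in> borel_measurable unit_measure"
      by (subst measurable_cong[of _ _ "\<lambda>_. 0"]) (auto simp: tau0)
    have "integrable unit_measure (\<lambda>z. 0 :: complex)" by simp
    then show "integrable unit_measure (\<lambda>z. adjoint_mult (tau \<mu> u y z) (Wmat z *v tau \<mu> u y z))"
      by (rule Bochner_Integration.integrable_cong[THEN iffD1, rotated 2])
        (auto simp: tau0 adjoint_mult_def)
  qed
  ultimately have "y \<in> T_domain \<mu> u"
    unfolding T_domain_def by simp
  moreover have "\<not> (AE z in unit_measure. y z = 0)"
  proof (rule not_AE_zero_if_continuous[OF cont _ z0(1)])
    have "y z0 $ 2 \<noteq> 0"
      using z0 p_pos[OF z0(1)] by (simp add: y_def)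
    then show "y z0 \<noteq> 0" by auto
  qed simp
  moreover have "AE z in unit_measure. T_op \<mu> u y z = 0 *s y z"
    by (intro AE_I2) (auto simp: T_op_def tau0)
  ultimately show ?thesis
    unfolding T_eigenvalue_def by blast
qed

end

section \<open>The equivalence of the two eigenvalue conditions\<close>

theorem lemma1:
  fixes \<mu> :: real and u :: "real^3"
  assumes "\<mu> \<ge> 0"
  shows "T_eigenvalue \<mu> u 0 \<longleftrightarrow>
    coulomb_spheroidal_eigenvalue \<mu>
      (- u$3 - 2 * (\<mu> + 1) * u$2)
      (u$1)
      (complex_of_real (u$3 + \<mu> * (\<mu> + 1)))"
proof -
  interpret coulomb_parameters \<mu> "u $ 1" "u $ 2" "u $ 3"
    using assms by unfold_locales
  show ?thesis
    unfolding coulomb_spheroidal_eigenvalue_iff_moderate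
  proof
    assume "T_eigenvalue \<mu> u 0"
    then obtain a b where ab: "canonical_system a b" "\<exists>z\<in>{0<..<1}. b z \<noteq> 0"
      "energy_density a b integrable_on {0<..<1}"
      by (rule T_eigenvalue_imp_canonical[OF refl refl refl])
    obtain K where "\<And>z. z \<in> {0<..<1} \<Longrightarrow> norm (b z) \<le> K * (z * (1 - z)) powr (- \<mu> / 2)"
      using moderate_if_energy_integrable[OF ab(1,3)] by blast
    with ab show "\<exists>a b K. canonical_system a b \<and> (\<exists>z\<in>{0<..<1}. b z \<noteq> 0) \<and>
        (\<forall>z\<in>{0<..<1}. norm (b z) \<le> K * (z * (1 - z)) powr (- \<mu> / 2))"
      by blast
  next
    assume "\<exists>a b K. canonical_system a b \<and> (\<exists>z\<in>{0<..<1}. b z \<noteq> 0) \<and>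
        (\<forall>z\<in>{0<..<1}. norm (b z) \<le> K * (z * (1 - z)) powr (- \<mu> / 2))"
    then obtain a b K z0 where sys: "canonical_system a b" and z0: "z0 \<in> {0<..<1}" "b z0 \<noteq> 0"
      and K: "\<And>z. z \<in> {0<..<1} \<Longrightarrow> norm (b z) \<le> K * (z * (1 - z)) powr (- \<mu> / 2)"
      by blast
    obtain B where "\<And>z. z \<in> {0<..<1} \<Longrightarrow> energy_density a b z \<le> B"
      using energy_bounded_if_moderate[OF sys K] by blast
    then show "T_eigenvalue \<mu> u 0"
      by (rule canonical_imp_T_eigenvalue[OF refl refl refl sys z0])
  qed
qed

end
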